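(* Let $A,B$ be finite-dimensional complex Hilbert spaces and let $|\psi\rangle,|\phi\rangle\in A\otimes B$ be nonzero (possibly unnormalized) vectors with Schmidt decompositions $|\psi\rangle=\sum_i\sqrt{r_i}\,|u_i\rangle|v_i\rangle$ and $|\phi\rangle=\sum_i\sqrt{t_i}\,|u_i'\rangle|v_i'\rangle$, $r_1\ge r_2\ge\dots$, $t_1\ge t_2\ge\dots$. Then there is a finite alphabet $\Sigma$ with $|\Sigma|\le \mathrm{SR}(|\phi\rangle)\cdot\mathrm{SR}(|\psi\rangle)$ such that $$F_{\mathrm{LOSR}}(|\psi\rangle,|\phi\rangle)=F_{\mathrm{LO}}(|\psi\rangle,|\phi\rangle)=\max_{P'\in\mathcal P(\Sigma)}F\bigl((R\otimes P')^{\downarrow},T^{\downarrow}_{\mathrm{embed}}\bigr),$$ where $R=\sum_i r_i|i\rangle\langle i|$, $T=\sum_i t_i|i\rangle\langle i|$, and $T_{\mathrm{embed}}$ is $T$ regarded (by padding with zeros) as a nonnegative vector on the joint alphabet indexing $R\otimes P'$. In particular, for unit vectors this is the optimal fidelity of converting $|\phi\rangle$ to $|\psi\rangle$ under local operations and shared randomness.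
   Context: $\mathrm{SR}(|\psi\rangle)$ is the Schmidt rank (number of nonzero Schmidt coefficients). $\mathcal P(\Sigma)$ is the set of probability distributions on $\Sigma$, identified with diagonal matrices. $X^{\downarrow}$ denotes the diagonal matrix whose diagonal entries are those of $X$ in decreasing order. Fidelity: $F(R,S)=\|\sqrt R\sqrt S\|_1^2$, which is $\bigl(\sum_i\sqrt{r_is_i}\bigr)^2$ for diagonal operators. Write $\psi=|\psi\rangle\langle\psi|$. The first argument is the target, the second the seed (initial) vector: $F_{\mathrm{LO}}(|\psi\rangle,|\phi\rangle)=\max_{\mathcal E,\mathcal F}F(\psi,(\mathcal E\otimes\mathcal F)(\phi))$ over quantum channels (completely positive trace-preserving maps) $\mathcal E$ on Alice's side and $\mathcal F$ on Bob's side, and $F_{\mathrm{LOSR}}(|\psi\rangle,|\phi\rangle)=\max_{\mu,\mathcal E_\lambda,\mathcal F_\lambda}F\bigl(\psi,\int(\mathcal E_\lambda\otimes\mathcal F_\lambda)(\phi)\,d\mu(\lambda)\bigr)$, with $\mu$ a probability measure over an index set for families of local channels $\{\mathcal E_\lambda\},\{\mathcal F_\lambda\}$. *)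

theory Defs
  imports "HOL-Probability.Probability_Measure"
begin

text \<open>
  A finite-dimensional complex Hilbert space is \<^typ>\<open>complex ^ 'a\<close>, and the tensor product of
  \<^typ>\<open>complex ^ 'a\<close> and \<^typ>\<open>complex ^ 'b\<close> is \<^typ>\<open>complex ^ ('a \<times> 'b)\<close>. The inner product
  below is conjugate-linear in its first argument; the library's \<open>inner\<close> on these types is only
  its real part.
\<close>

definition cinner :: "complex ^ 'n \<Rightarrow> complex ^ 'n::finite \<Rightarrow> complex" where
  "cinner x y = (\<Sum>i\<in>UNIV. cnj (x $ i) * y $ i)"

definition cadjoint :: "complex ^ 'n ^ 'm \<Rightarrow> complex ^ 'm ^ 'n" where
  "cadjoint M = (\<chi> i j. cnj (M $ j $ i))"

definition mscale :: "complex \<Rightarrow> complex ^ 'n ^ 'm \<Rightarrow> complex ^ 'n ^ 'm" where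
  "mscale c M = map_matrix ((*) c) M"

definition diag :: "('n \<Rightarrow> real) \<Rightarrow> complex ^ 'n ^ 'n" where
  "diag d = (\<chi> i j. if i = j then complex_of_real (d i) else 0)"

definition tensor_vec :: "complex ^ 'a \<Rightarrow> complex ^ 'b \<Rightarrow> complex ^ ('a \<times> 'b)" where
  "tensor_vec x y = (\<chi> p. x $ fst p * y $ snd p)"

definition tensor_mat ::
    "complex ^ 'a ^ 'a \<Rightarrow> complex ^ 'b ^ 'b \<Rightarrow> complex ^ ('a \<times> 'b) ^ ('a \<times> 'b)" where
  "tensor_mat X Y = (\<chi> p q. X $ fst p $ fst q * Y $ snd p $ snd q)"

text \<open>The rank-one operator \<open>|x><x|\<close>.\<close>

definition proj :: "complex ^ 'n \<Rightarrow> complex ^ 'n ^ 'n" where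
  "proj x = (\<chi> i j. x $ i * cnj (x $ j))"


section \<open>Fidelity\<close>

text \<open>Membership in the nonnegative reals for all \<open>x\<close> forces \<open>M\<close> to be Hermitian.\<close>

definition psd :: "complex ^ 'n::finite ^ 'n \<Rightarrow> bool" where
  "psd M \<longleftrightarrow> (\<forall>x. cinner x (M *v x) \<in> \<real>\<^sub>\<ge>\<^sub>0)"

definition psd_sqrt :: "complex ^ 'n::finite ^ 'n \<Rightarrow> complex ^ 'n ^ 'n" where
  "psd_sqrt M = (THE Q. psd Q \<and> Q ** Q = M)"

definition trace_norm :: "complex ^ 'n::finite ^ 'n \<Rightarrow> real" where
  "trace_norm X = Re (trace (psd_sqrt (cadjoint X ** X)))"

definition fidelity :: "complex ^ 'n::finite ^ 'n \<Rightarrow> complex ^ 'n ^ 'n \<Rightarrow> real" where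
  "fidelity R S = (trace_norm (psd_sqrt R ** psd_sqrt S))\<^sup>2"

text \<open>
  Fidelity of the diagonal operators with diagonals \<open>r\<close> and \<open>s\<close> over the index set \<open>I\<close>. A separate
  constant is needed because \<open>I\<close> will be a set depending on other variables rather than a type;
  lemma \<open>diag_fidelity_eq_fidelity\<close> shows that it is the operator fidelity of the diagonal matrices
  over any index type in bijection with \<open>I\<close>.
\<close>

definition diag_fidelity :: "'i set \<Rightarrow> ('i \<Rightarrow> real) \<Rightarrow> ('i \<Rightarrow> real) \<Rightarrow> real" where
  "diag_fidelity I r s = (\<Sum>i\<in>I. sqrt (r i * s i))\<^sup>2"


lemma cinner_add_right: "cinner x (y + z) = cinner x y + cinner x z"
  and cinner_add_left: "cinner (x + y) z = cinner x z + cinner y z"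
  and cinner_diff_right: "cinner x (y - z) = cinner x y - cinner x z"
  and cinner_diff_left: "cinner (x - y) z = cinner x z - cinner y z"
  and cinner_scale_right: "cinner x (c *s y) = c * cinner x y"
  and cinner_scale_left: "cinner (c *s x) y = cnj c * cinner x y"
  by (simp_all add: cinner_def algebra_simps sum.distrib sum_subtractf sum_distrib_left)

lemma cnj_cinner: "cnj (cinner x y) = cinner y x"
  by (simp add: cinner_def mult.commute)

lemma cinner_self: "cinner x x = complex_of_real (\<Sum>i\<in>UNIV. (cmod (x $ i))\<^sup>2)"
  unfolding cinner_def of_real_sum
  by (intro sum.cong refl) (metis complex_norm_square mult.commute of_real_power)

lemma cinner_self_eq_0 [simp]: "cinner x x = 0 \<longleftrightarrow> x = 0"
  by (auto simp: cinner_self sum_nonneg_eq_0_iff vec_eq_iff simp del: of_real_sum)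

lemma cinner_mult_right: "cinner x (M *v y) = cinner (cadjoint M *v x) y"
proof -
  have "cinner x (M *v y) = (\<Sum>i\<in>UNIV. \<Sum>j\<in>UNIV. cnj (x $ i) * (M $ i $ j * y $ j))"
    by (simp add: cinner_def matrix_vector_mult_def sum_distrib_left)
  also have "\<dots> = (\<Sum>j\<in>UNIV. \<Sum>i\<in>UNIV. cnj (x $ i) * (M $ i $ j * y $ j))"
    by (rule sum.swap)
  also have "\<dots> = cinner (cadjoint M *v x) y"
    by (simp add: cinner_def matrix_vector_mult_def cadjoint_def sum_distrib_left
        sum_distrib_right mult_ac)
  finally show ?thesis .
qed

lemma cinner_axis: "cinner (axis i 1) x = x $ i"
  unfolding cinner_def axis_def
  by (simp add: if_distrib[of cnj] if_distrib[of "\<lambda>a. a * _"] sum.delta' cong: if_cong)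

lemma mult_axis: "((M :: complex ^ 'n::finite ^ 'm) *v axis i 1) $ j = M $ j $ i"
  by (simp add: matrix_vector_mult_def axis_def if_distrib[of "\<lambda>a. _ * a"] cong: if_cong)

lemma psd_hermitian:
  assumes "psd M" shows "cadjoint M = M"
proof -
  define B where "B x y = cinner x (M *v y)" for x y
  have r: "cnj (B x x) = B x x" for x
    using assms unfolding psd_def B_def by (metis Reals_cnj_iff nonneg_Reals_subset_Reals subsetD)
  have e: "B (x + c *s y) (x + c *s y) = B x x + c * B x y + cnj c * B y x + cnj c * c * B y y"
    for x y c
    by (simp add: B_def matrix_vector_right_distrib vector_scalar_commute cinner_add_right
        cinner_add_left cinner_scale_left cinner_scale_right algebra_simps)
  have "cnj (B x y) = B y x" for x y
  proof -
    have 1: "cnj (B x y + B y x) = B x y + B y x"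
      using r[of "x + 1 *s y"] r[of x] r[of y] unfolding e by simp
    have 2: "cnj (\<i> * B x y - \<i> * B y x) = \<i> * B x y - \<i> * B y x"
      using r[of "x + \<i> *s y"] r[of x] r[of y] unfolding e by simp
    show ?thesis using 1 2 by (simp add: complex_eq_iff)
  qed
  then have "cnj (B (axis j 1) (axis i 1)) = B (axis i 1) (axis j 1)" for i j by simp
  then show ?thesis
    by (simp add: B_def cinner_axis mult_axis vec_eq_iff cadjoint_def)
qed

lemma psd_kernel:
  assumes "psd M" "cinner x (M *v x) = 0" shows "M *v x = 0"
proof (rule ccontr)
  define y where "y = M *v x"
  assume "M *v x \<noteq> 0"
  then have y: "y \<noteq> 0" by (simp add: y_def)
  have h: "cadjoint M = M" using assms(1) by (rule psd_hermitian)
  define a where "a = Re (cinner y y)"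
  define b where "b = Re (cinner y (M *v y))"
  have pos: "0 \<le> Re (cinner z (M *v z))" for z
    using assms(1) by (auto simp: psd_def complex_nonneg_Reals_iff)
  have a: "a > 0" using y
    unfolding a_def cinner_self by (simp add: vec_eq_iff) (metis (no_types, lifting) finite_class.finite_UNIV
        UNIV_I norm_eq_zero not_less order_le_less sum_nonneg_eq_0_iff sum_nonneg zero_le_power2 power_eq_0_iff zero_index)
  have b: "b \<ge> 0" unfolding b_def by (rule pos)
  have xy: "cinner x (M *v y) = cinner y y"
    by (simp add: cinner_mult_right h y_def)
  define e where "e = a / (b + 1)"
  have e: "e > 0" using a b by (simp add: e_def)
  have "cinner (x - of_real e *s y) (M *v (x - of_real e *s y)) =
      of_real e * of_real e * cinner y (M *v y) - 2 * of_real e * cinner y y"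
    using assms(2)
    by (simp add: matrix_vector_mult_diff_distrib vector_scalar_commute cinner_diff_right xy
        cinner_diff_left cinner_scale_left cinner_scale_right algebra_simps flip: y_def)
  then have "0 \<le> e * e * b - 2 * e * a"
    using pos[of "x - of_real e *s y"] by (simp add: a_def b_def)
  then have "2 * a \<le> e * b" using e by (simp add: mult.assoc mult.left_commute)
  also have "e * b \<le> a" using a b by (simp add: e_def field_simps)
  finally show False using a by simp
qed

lemma psd_sqrt_unique:
  assumes "psd P" "psd Q" "P ** P = Q ** Q" shows "P = Q"
proof -
  define D where "D = P - Q"
  have hD: "cadjoint D = D"
    using psd_hermitian[OF assms(1)] psd_hermitian[OF assms(2)]
    by (simp add: D_def cadjoint_def vec_eq_iff)
  have anti: "D ** (P + Q) = - ((P + Q) ** D)"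
    using assms(3) by (simp add: D_def vec_eq_iff matrix_matrix_mult_def algebra_simps sum.distrib sum_subtractf)
  have "trace (D ** ((P + Q) ** D)) = - trace (D ** ((P + Q) ** D))"
  proof -
    have "trace (D ** ((P + Q) ** D)) = trace (((P + Q) ** D) ** D)" by (rule trace_mul_sym)
    also have "((P + Q) ** D) ** D = - (D ** (P + Q) ** D)"
      unfolding anti by (simp add: vec_eq_iff matrix_matrix_mult_def sum_negf)
    finally show ?thesis by (simp add: matrix_mul_assoc trace_def sum_negf)
  qed
  then have tr: "trace (D ** (P + Q) ** D) = 0" by (simp add: matrix_mul_assoc)
  define d where "d i = D *v axis i 1" for i
  have di: "(D ** M ** D) $ i $ i = cinner (d i) (M *v d i)" for M i
  proof -
    have "(D ** M ** D) $ i $ i = cinner (axis i 1) ((D ** M ** D) *v axis i 1)"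
      by (simp add: cinner_axis mult_axis)
    also have "\<dots> = cinner (d i) (M *v d i)"
      by (simp add: d_def cinner_mult_right[of _ D] hD flip: matrix_vector_mul_assoc)
    finally show ?thesis .
  qed
  have pp: "cinner x (P *v x) \<in> \<real>\<^sub>\<ge>\<^sub>0" "cinner x (Q *v x) \<in> \<real>\<^sub>\<ge>\<^sub>0" for x
    using assms by (auto simp: psd_def)
  have "(\<Sum>i\<in>UNIV. Re (cinner (d i) (P *v d i)) + Re (cinner (d i) (Q *v d i))) = 0"
    using tr by (simp add: trace_def di matrix_vector_mult_add_rdistrib cinner_add_right complex_eq_iff)
  then have z: "Re (cinner (d i) (P *v d i)) + Re (cinner (d i) (Q *v d i)) = 0" for i
    using pp by (subst (asm) sum_nonneg_eq_0_iff) (auto simp: complex_nonneg_Reals_iff)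
  have "P *v d i = 0 \<and> Q *v d i = 0" for i
    using z[of i] pp[of "d i"]
    by (intro conjI psd_kernel assms) (auto simp: complex_nonneg_Reals_iff complex_eq_iff)
  then have "D *v d i = 0" for i by (simp add: D_def matrix_vector_mult_diff_rdistrib)
  then have "cinner (d i) (d i) = 0" for i
    using cinner_mult_right[of "axis i 1" D "d i"] hD by (simp add: d_def cinner_def)
  then have "D *v axis i 1 = 0" for i by (simp add: d_def)
  then have "D = 0" by (simp add: vec_eq_iff) (metis mult_axis zero_index)
  then show ?thesis by (simp add: D_def)
qed

lemma psd_sqrt_eq: "psd Q \<Longrightarrow> psd_sqrt (Q ** Q) = Q"
  unfolding psd_sqrt_def by (rule the_equality) (auto intro: psd_sqrt_unique)

lemma diag_mult: "diag a ** diag b = diag (\<lambda>i. a i * b i)"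
  by (auto simp: diag_def matrix_matrix_mult_def vec_eq_iff if_distrib[of "\<lambda>a. a * _"] sum.delta
      cong: if_cong)

lemma psd_diag: "(\<And>i. 0 \<le> a i) \<Longrightarrow> psd (diag a)"
proof -
  assume a: "\<And>i. 0 \<le> a i"
  have "cinner x (diag a *v x) = complex_of_real (\<Sum>i\<in>UNIV. a i * (cmod (x $ i))\<^sup>2)" for x
    unfolding cinner_def of_real_sum
    by (intro sum.cong refl)
      (simp add: diag_def matrix_vector_mult_def if_distrib[of "\<lambda>a. a * _"] complex_norm_square
        mult.left_commute cong: if_cong, metis complex_norm_square mult.commute of_real_power)
  then show ?thesis using a by (auto simp: psd_def simp del: of_real_sum intro!: sum_nonneg)
qed

lemma psd_sqrt_diag:
  assumes "\<And>i. 0 \<le> a i" shows "psd_sqrt (diag a) = diag (\<lambda>i. sqrt (a i))"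
  using psd_sqrt_eq[OF psd_diag[of "\<lambda>i. sqrt (a i)"]] assms by (simp add: diag_mult)

lemma fidelity_diag:
  assumes "\<And>i. 0 \<le> r i" "\<And>i. 0 \<le> s i"
  shows "fidelity (diag r) (diag s) = diag_fidelity UNIV r s"
proof -
  have "cadjoint (diag a) = diag a" for a :: "'a \<Rightarrow> real"
    by (auto simp: cadjoint_def diag_def vec_eq_iff)
  then show ?thesis using assms
    by (simp add: fidelity_def diag_fidelity_def trace_norm_def psd_sqrt_diag diag_mult real_sqrt_mult)
      (simp add: diag_def trace_def)
qed

lemma diag_fidelity_eq_fidelity:
  fixes f :: "'n::finite \<Rightarrow> 'i"
  assumes "bij_betw f UNIV I" "\<And>i. i \<in> I \<Longrightarrow> 0 \<le> r i" "\<And>i. i \<in> I \<Longrightarrow> 0 \<le> s i"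
  shows "diag_fidelity I r s = fidelity (diag (r \<circ> f)) (diag (s \<circ> f))"
proof -
  have "f i \<in> I" for i using assms(1) by (auto simp: bij_betw_def)
  then show ?thesis
    using sum.reindex_bij_betw[OF assms(1), of "\<lambda>i. sqrt (r i * s i)"] assms
    by (subst fidelity_diag) (auto simp: diag_fidelity_def)
qed


section \<open>Schmidt decompositions\<close>

definition orthonormal :: "nat \<Rightarrow> (nat \<Rightarrow> complex ^ 'n::finite) \<Rightarrow> bool" where
  "orthonormal n u \<longleftrightarrow> (\<forall>i<n. \<forall>j<n. cinner (u i) (u j) = (if i = j then 1 else 0))"

text \<open>
  Indices run from \<open>0\<close> to \<open>n - 1\<close>, and coefficients may vanish, so that both the convention with
  strictly positive coefficients and the one with \<open>min (dim A) (dim B)\<close> terms are covered.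
\<close>

definition schmidt_decomposition ::
    "complex ^ ('a::finite \<times> 'b::finite) \<Rightarrow> nat \<Rightarrow> (nat \<Rightarrow> real) \<Rightarrow>
      (nat \<Rightarrow> complex ^ 'a) \<Rightarrow> (nat \<Rightarrow> complex ^ 'b) \<Rightarrow> bool" where
  "schmidt_decomposition \<psi> n r u v \<longleftrightarrow>
     (\<forall>i<n. 0 \<le> r i) \<and> (\<forall>i j. i \<le> j \<and> j < n \<longrightarrow> r j \<le> r i) \<and>
     orthonormal n u \<and> orthonormal n v \<and>
     \<psi> = (\<Sum>i<n. complex_of_real (sqrt (r i)) *s tensor_vec (u i) (v i))"

definition schmidt_rank :: "complex ^ ('a::finite \<times> 'b::finite) \<Rightarrow> nat" where
  "schmidt_rank \<psi> = (THE k. \<exists>n r u v. schmidt_decomposition \<psi> n r u v \<and>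
      k = card {i. i < n \<and> r i \<noteq> 0})"


lemma cinner_sum_right: "cinner x (\<Sum>i\<in>A. f i) = (\<Sum>i\<in>A. cinner x (f i))"
  unfolding cinner_def by (simp add: sum_distrib_left) (rule sum.swap)

lemma schmidt_coefficients_card_unique:
  assumes "schmidt_decomposition \<psi> n r u v"
  shows "card {i. i < n \<and> r i \<noteq> 0} =
    vec.dim (range (\<lambda>y. \<chi> a. \<Sum>b\<in>UNIV. \<psi> $ (a, b) * cnj (y $ b)))"
proof -
  let ?c = "\<lambda>y. \<chi> a. \<Sum>b\<in>UNIV. \<psi> $ (a, b) * cnj (y $ b)"
  let ?S = "{i. i < n \<and> r i \<noteq> 0}"
  note d = assms[unfolded schmidt_decomposition_def orthonormal_def]
  have c: "?c y = (\<Sum>i\<in>?S. (sqrt (r i) * cinner y (v i)) *s u i)" for y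
  proof -
    have "?c y = (\<Sum>i<n. (sqrt (r i) * cinner y (v i)) *s u i)"
      unfolding vec_eq_iff
    proof safe
      fix a
      have "?c y $ a = (\<Sum>b\<in>UNIV. \<Sum>i<n. sqrt (r i) * (u i $ a * v i $ b) * cnj (y $ b))"
        using d by (simp add: tensor_vec_def sum_distrib_right)
      also have "\<dots> = (\<Sum>i<n. \<Sum>b\<in>UNIV. sqrt (r i) * (u i $ a * v i $ b) * cnj (y $ b))"
        by (rule sum.swap)
      also have "\<dots> = (\<Sum>i<n. (sqrt (r i) * cinner y (v i)) *s u i) $ a"
        by (simp add: cinner_def sum_distrib_left sum_distrib_right mult_ac)
      finally show "?c y $ a = (\<Sum>i<n. (sqrt (r i) * cinner y (v i)) *s u i) $ a" .
    qed
    also have "\<dots> = (\<Sum>i\<in>?S. (sqrt (r i) * cinner y (v i)) *s u i)"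
      by (rule sum.mono_neutral_right) auto
    finally show ?thesis .
  qed
  have on: "cinner (u i) (u j) = (if i = j then 1 else 0)" if "i \<in> ?S" "j \<in> ?S" for i j
    using d that by auto
  have inj: "inj_on u ?S"
    
  proof (rule inj_onI)
    fix i j assume "i \<in> ?S" "j \<in> ?S" "u i = u j"
    then show "i = j" using on[of i j] on[of i i] by (auto split: if_splits)
  qed
  have ind: "vec.independent (u ` ?S)"
  proof (rule vec.independent_if_scalars_zero)
    fix f x assume s: "(\<Sum>x\<in>u ` ?S. f x *s x) = 0" and "x \<in> u ` ?S"
    then obtain j where j: "j \<in> ?S" "x = u j" by auto
    have "0 = cinner (u j) (\<Sum>i\<in>?S. f (u i) *s u i)"
      using s by (simp add: sum.reindex[OF inj] cinner_def)
    also have "\<dots> = (\<Sum>i\<in>?S. if i = j then f (u i) else 0)"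
      unfolding cinner_sum_right using j
      by (intro sum.cong refl) (use on in \<open>auto simp: cinner_scale_right\<close>)
    also have "\<dots> = f (u j)" using j by (subst sum.delta) auto
    finally show "f x = 0" using j by simp
  qed auto
  have "range ?c = vec.span (u ` ?S)"
  proof safe
    fix y show "?c y \<in> vec.span (u ` ?S)"
      unfolding c by (intro vec.span_sum vec.span_scale vec.span_base) auto
  next
    fix x assume "x \<in> vec.span (u ` ?S)"
    then obtain f where x: "x = (\<Sum>i\<in>?S. f (u i) *s u i)"
      by (auto simp: vec.span_finite sum.reindex[OF inj])
    define y where "y = (\<Sum>i\<in>?S. cnj (f (u i) / sqrt (r i)) *s v i)"
    have "cinner y (v j) = f (u j) / sqrt (r j)" if "j \<in> ?S" for j
    proof -
      have "cnj (cinner y (v j)) = cinner (v j) y" by (rule cnj_cinner)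
      also have "\<dots> = (\<Sum>i\<in>?S. if i = j then cnj (f (u i) / sqrt (r i)) else 0)"
        unfolding y_def cinner_sum_right using that d
        by (intro sum.cong refl) (auto simp: cinner_scale_right)
      also have "\<dots> = cnj (f (u j) / sqrt (r j))" using that by (subst sum.delta) auto
      finally show ?thesis by (simp only: complex_cnj_cancel_iff)
    qed
    then have "?c y = x" unfolding c x by (intro sum.cong refl) auto
    then show "x \<in> range ?c" by (rule range_eqI[OF sym])
  qed
  then show ?thesis
    using vec.dim_span_eq_card_independent[OF ind] card_image[OF inj] by simp
qed

lemma schmidt_rank_eq:
  assumes "schmidt_decomposition \<psi> n r u v"
  shows "schmidt_rank \<psi> = card {i. i < n \<and> r i \<noteq> 0}"
  unfolding schmidt_rank_def
proof (rule the_equality)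
  show "\<exists>n' r' u' v'. schmidt_decomposition \<psi> n' r' u' v' \<and>
      card {i. i < n \<and> r i \<noteq> 0} = card {i. i < n' \<and> r' i \<noteq> 0}"
    using assms by blast
next
  fix k assume "\<exists>n' r' u' v'. schmidt_decomposition \<psi> n' r' u' v' \<and>
      k = card {i. i < n' \<and> r' i \<noteq> 0}"
  then show "k = card {i. i < n \<and> r i \<noteq> 0}"
    using schmidt_coefficients_card_unique[OF assms] schmidt_coefficients_card_unique by fastforce
qed


section \<open>Quantum channels\<close>

text \<open>
  A positive operator on \<open>\<complex>\<^sup>k \<otimes> A\<close>, written as a \<open>k \<times> k\<close> block matrix \<open>Y\<close> with entries in the
  operators on \<open>A\<close> and tested on block vectors \<open>x\<close>. Complete positivity of \<open>E\<close> says that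
  \<open>id\<^sub>k \<otimes> E\<close>, which applies \<open>E\<close> to each block, is positive for every \<open>k\<close>.
\<close>

definition block_psd :: "nat \<Rightarrow> (nat \<Rightarrow> nat \<Rightarrow> complex ^ 'a::finite ^ 'a) \<Rightarrow> bool" where
  "block_psd k Y \<longleftrightarrow>
     (\<forall>x. (\<Sum>p<k. \<Sum>q<k. cinner (x p) (Y p q *v x q)) \<in> \<real>\<^sub>\<ge>\<^sub>0)"

definition completely_positive ::
    "(complex ^ 'a::finite ^ 'a \<Rightarrow> complex ^ 'a ^ 'a) \<Rightarrow> bool" where
  "completely_positive E \<longleftrightarrow> (\<forall>k Y. block_psd k Y \<longrightarrow> block_psd k (\<lambda>p q. E (Y p q)))"

definition channel :: "(complex ^ 'a::finite ^ 'a \<Rightarrow> complex ^ 'a ^ 'a) \<Rightarrow> bool" where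
  "channel E \<longleftrightarrow> Vector_Spaces.linear mscale mscale E \<and> completely_positive E \<and>
     (\<forall>X. trace (E X) = trace X)"

definition unit_mat :: "'n \<Rightarrow> 'n \<Rightarrow> complex ^ 'n ^ 'n" where
  "unit_mat i j = (\<chi> k l. if k = i \<and> l = j then 1 else 0)"

text \<open>
  \<open>E \<otimes> F\<close>, by expanding the argument in the products of matrix units; see \<open>tensor_map_tensor_mat\<close>.
\<close>

definition tensor_map ::
    "(complex ^ 'a::finite ^ 'a \<Rightarrow> complex ^ 'a ^ 'a) \<Rightarrow>
     (complex ^ 'b::finite ^ 'b \<Rightarrow> complex ^ 'b ^ 'b) \<Rightarrow>
     complex ^ ('a \<times> 'b) ^ ('a \<times> 'b) \<Rightarrow> complex ^ ('a \<times> 'b) ^ ('a \<times> 'b)" where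
  "tensor_map E F M = (\<Sum>i\<in>UNIV. \<Sum>j\<in>UNIV. \<Sum>k\<in>UNIV. \<Sum>l\<in>UNIV.
     mscale (M $ (i, k) $ (j, l)) (tensor_mat (E (unit_mat i j)) (F (unit_mat k l))))"


lemma vector_space_mscale: "vector_space (mscale :: complex \<Rightarrow> complex ^ 'n ^ 'm \<Rightarrow> _)"
  by standard (simp_all add: mscale_def map_matrix_def vec_eq_iff algebra_simps)

lemma tensor_map_tensor_mat:
  assumes "Vector_Spaces.linear mscale mscale E" "Vector_Spaces.linear mscale mscale F"
  shows "tensor_map E F (tensor_mat X Y) = tensor_mat (E X) (F Y)"
proof -
  interpret E: Vector_Spaces.linear mscale mscale E by fact
  interpret F: Vector_Spaces.linear mscale mscale F by fact
  have X: "X = (\<Sum>i\<in>UNIV. \<Sum>j\<in>UNIV. mscale (X $ i $ j) (unit_mat i j))" for X :: "complex ^ 'n::finite ^ 'n"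
    unfolding vec_eq_iff
  proof safe
    fix a b
    have "(\<Sum>i\<in>UNIV. \<Sum>j\<in>UNIV. mscale (X $ i $ j) (unit_mat i j)) $ a $ b =
        (\<Sum>i\<in>UNIV. \<Sum>j\<in>UNIV. if j = b then if i = a then X $ i $ j else 0 else 0)"
      unfolding sum_component
      by (intro sum.cong refl) (auto simp: mscale_def map_matrix_def unit_mat_def)
    also have "\<dots> = X $ a $ b" by simp
    finally show "X $ a $ b = (\<Sum>i\<in>UNIV. \<Sum>j\<in>UNIV. mscale (X $ i $ j) (unit_mat i j)) $ a $ b" ..
  qed
  have e: "E X = (\<Sum>i\<in>UNIV. \<Sum>j\<in>UNIV. mscale (X $ i $ j) (E (unit_mat i j)))"
    by (subst X) (simp add: E.sum E.scale)
  have f: "F Y = (\<Sum>i\<in>UNIV. \<Sum>j\<in>UNIV. mscale (Y $ i $ j) (F (unit_mat i j)))"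
    by (subst X) (simp add: F.sum F.scale)
  have swap: "(\<Sum>k\<in>UNIV. \<Sum>i\<in>UNIV. \<Sum>l\<in>UNIV. \<Sum>j\<in>UNIV. h i j k l) =
      (\<Sum>i\<in>UNIV. \<Sum>j\<in>UNIV. \<Sum>k\<in>UNIV. \<Sum>l\<in>UNIV. h i j k l)"
    for h :: "'a \<Rightarrow> 'a \<Rightarrow> 'b \<Rightarrow> 'b \<Rightarrow> complex"
  proof -
    have "(\<Sum>k\<in>UNIV. \<Sum>i\<in>UNIV. \<Sum>l\<in>UNIV. \<Sum>j\<in>UNIV. h i j k l) =
        (\<Sum>i\<in>UNIV. \<Sum>k\<in>UNIV. \<Sum>l\<in>UNIV. \<Sum>j\<in>UNIV. h i j k l)" by (rule sum.swap)
    also have "\<dots> = (\<Sum>i\<in>UNIV. \<Sum>k\<in>UNIV. \<Sum>j\<in>UNIV. \<Sum>l\<in>UNIV. h i j k l)"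
      by (intro sum.cong refl sum.swap)
    also have "\<dots> = (\<Sum>i\<in>UNIV. \<Sum>j\<in>UNIV. \<Sum>k\<in>UNIV. \<Sum>l\<in>UNIV. h i j k l)"
      by (intro sum.cong refl sum.swap)
    finally show ?thesis .
  qed
  have "tensor_mat (E X) (F Y) $ p $ q = tensor_map E F (tensor_mat X Y) $ p $ q" for p q
    unfolding e f
    by (simp add: tensor_map_def tensor_mat_def mscale_def map_matrix_def sum_distrib_left
        sum_distrib_right mult_ac swap)
  then show ?thesis by (simp add: vec_eq_iff)
qed


section \<open>Optimal conversion fidelities\<close>

definition has_maximum :: "real set \<Rightarrow> bool" where
  "has_maximum S \<longleftrightarrow> (\<exists>m\<in>S. \<forall>x\<in>S. x \<le> m)"

text \<open>Meaningful only if \<open>has_maximum S\<close>; Isabelle's \<open>Max\<close> is restricted to finite sets.\<close>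

definition maximum :: "real set \<Rightarrow> real" where
  "maximum S = (GREATEST m. m \<in> S)"

text \<open>In all of the following, the first vector is the target and the second one the seed.\<close>

definition LO_fidelities ::
    "complex ^ ('a::finite \<times> 'b::finite) \<Rightarrow> complex ^ ('a \<times> 'b) \<Rightarrow> real set" where
  "LO_fidelities \<psi> \<phi> =
     {fidelity (proj \<psi>) (tensor_map E F (proj \<phi>)) | E F. channel E \<and> channel F}"

definition F_LO :: "complex ^ ('a::finite \<times> 'b::finite) \<Rightarrow> complex ^ ('a \<times> 'b) \<Rightarrow> real" where
  "F_LO \<psi> \<phi> = maximum (LO_fidelities \<psi> \<phi>)"

text \<open>
  The shared randomness is a probability measure \<open>\<mu>\<close> on (a subset \<open>space \<mu>\<close> of) an arbitrary type
  \<open>'l\<close>. HOL cannot quantify over types inside a formula, so \<open>'l\<close> is a parameter. The only regularity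
  asked of the families of channels is that the integral exists.
\<close>

definition LOSR_fidelities ::
    "'l itself \<Rightarrow> complex ^ ('a::finite \<times> 'b::finite) \<Rightarrow> complex ^ ('a \<times> 'b) \<Rightarrow> real set" where
  "LOSR_fidelities _ \<psi> \<phi> =
     {fidelity (proj \<psi>) (\<integral>l. tensor_map (E l) (F l) (proj \<phi>) \<partial>\<mu>) | (\<mu> :: 'l measure) E F.
        prob_space \<mu> \<and>
        (\<forall>l\<in>space \<mu>. channel (E l) \<and> channel (F l)) \<and>
        integrable \<mu> (\<lambda>l. tensor_map (E l) (F l) (proj \<phi>))}"

definition F_LOSR ::
    "'l itself \<Rightarrow> complex ^ ('a::finite \<times> 'b::finite) \<Rightarrow> complex ^ ('a \<times> 'b) \<Rightarrow> real" where
  "F_LOSR L \<psi> \<phi> = maximum (LOSR_fidelities L \<psi> \<phi>)"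


section \<open>The classical side\<close>

definition prob_dists :: "'s set \<Rightarrow> ('s \<Rightarrow> real) set" where
  "prob_dists \<Sigma> = {p. (\<forall>s\<in>\<Sigma>. 0 \<le> p s) \<and> (\<Sum>s\<in>\<Sigma>. p s) = 1}"

text \<open>
  The diagonal \<open>f\<close> over the finite index set \<open>I\<close>, rearranged in decreasing order; the result is
  indexed by \<open>{..<card I}\<close>.
\<close>

definition decreasing :: "'i set \<Rightarrow> ('i \<Rightarrow> real) \<Rightarrow> nat \<Rightarrow> real" where
  "decreasing I f k = rev (sorted_list_of_multiset (image_mset f (mset_set I))) ! k"

text \<open>
  The diagonal \<open>t 0, \<dots>, t (m - 1)\<close> placed on the finite index set \<open>J\<close> and padded with zeros. For
  finite \<open>J\<close>, \<open>to_nat_on J\<close> is a bijection from \<open>J\<close> onto \<open>{..<card J}\<close>. Nothing but zeros is lost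
  as long as \<open>t\<close> has no nonzero entry at or beyond \<open>card J\<close>.
\<close>

definition embed_diag :: "'i set \<Rightarrow> nat \<Rightarrow> (nat \<Rightarrow> real) \<Rightarrow> 'i \<Rightarrow> real" where
  "embed_diag J m t x = (if to_nat_on J x < m then t (to_nat_on J x) else 0)"

text \<open>
  The values of the fidelity between the rearrangements of \<open>R \<otimes> P\<close> and of the embedded \<open>T\<close> on the
  joint alphabet \<open>{..<n} \<times> \<Sigma>\<close>, where \<open>R\<close> has the diagonal \<open>r 0, \<dots>, r (n - 1)\<close> and \<open>T\<close> the diagonal
  \<open>t 0, \<dots>, t (m - 1)\<close>.
\<close>

definition classical_fidelities ::
    "'s set \<Rightarrow> nat \<Rightarrow> (nat \<Rightarrow> real) \<Rightarrow> nat \<Rightarrow> (nat \<Rightarrow> real) \<Rightarrow> real set" where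
  "classical_fidelities \<Sigma> n r m t =
     (let J = {..<n} \<times> \<Sigma> in
       {diag_fidelity {..<card J} (decreasing J (\<lambda>(i, s). r i * p s))
          (decreasing J (embed_diag J m t)) | p. p \<in> prob_dists \<Sigma>})"

end

theory Submission
  imports Defs
begin

text \<open>
  Since the target is pure, the fidelity is \<open><\<psi>| \<sigma> |\<psi>>\<close>, which is linear in the output state
  \<open>\<sigma>\<close>; hence shared randomness does not help. With Kraus operators \<open>A\<^sub>c\<close>, \<open>B\<^sub>d\<close> of the two
  channels the fidelity is the squared Frobenius norm of the matrix \<open>N\<^sub>c\<^sub>d = <\<psi>| A\<^sub>c \<otimes> B\<^sub>d |\<phi>>\<close>.
  In the singular bases of \<open>N\<close>, AM-GM and Bessel's inequality bound its singular values \<open>s\<^sub>j\<close> by sums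
  against a doubly substochastic matrix pairing the \<open>t\<^sub>k\<close> with the \<open>r\<^sub>i p\<^sub>j\<close>, where \<open>p\<^sub>j\<close> is
  proportional to \<open>s\<^sub>j\<^sup>2\<close>, and the rearrangement inequality replaces that matrix by an injection \<open>g\<close>
  from the \<open>K = SR(\<phi>)\<close> nonzero coefficients of \<open>\<phi>\<close> to pairs \<open>(i, j)\<close>. For fixed \<open>g\<close>,
  the optimum over \<open>p\<close> is given by Cauchy-Schwarz, so both sides of the theorem are the maximum of the
  resulting value over the finitely many \<open>g\<close>. At most \<open>K\<close> values of \<open>j\<close> occur, so an
  alphabet of \<open>K\<close> letters suffices. Conversely, an injection \<open>g\<close> is realized by the channels with
  Kraus operators \<open>\<Sum>\<^sub>k |u\<^sub>i><u'\<^sub>k|\<close>, summed over the \<open>k\<close> with \<open>g k = (i, s)\<close>.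
\<close>


section \<open>Positive semidefinite matrices\<close>

definition outer :: "complex ^ 'm \<Rightarrow> complex ^ 'n \<Rightarrow> complex ^ 'n ^ 'm" where
  "outer x y = (\<chi> i j. x $ i * cnj (y $ j))"

lemma proj_eq_outer: "proj x = outer x x"
  by (simp add: proj_def outer_def)

lemma outer_mult_vec: "outer x y *v z = cinner y z *s x"
  by (simp add: outer_def cinner_def matrix_vector_mult_def vec_eq_iff sum_distrib_left mult_ac)

lemma cinner_self_norm: "cinner x x = complex_of_real ((norm x)\<^sup>2)"
  by (simp add: cinner_self norm_vec_def L2_set_def sum_nonneg del: of_real_sum)

lemma cinner_zero [simp]: "cinner 0 x = 0" "cinner x 0 = 0"
  by (simp_all add: cinner_def)

lemma cinner_sum_left: "cinner (\<Sum>i\<in>A. f i) x = (\<Sum>i\<in>A. cinner (f i) x)"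
  using cinner_sum_right[of x f A] by (metis (no_types, lifting) cnj_cinner cnj_sum sum.cong)

lemma mscale_mult_vec: "mscale c M *v x = c *s (M *v x)"
  by (simp add: mscale_def map_matrix_def matrix_vector_mult_def vec_eq_iff sum_distrib_left mult_ac)

lemma sum_mult_vec: "(\<Sum>i\<in>I. M i) *v x = (\<Sum>i\<in>I. (M i :: complex ^ 'n::finite ^ 'm) *v x)"
  by (induction I rule: infinite_finite_induct) (simp_all add: matrix_vector_mult_add_rdistrib)

lemma mult_vec_sum: "M *v (\<Sum>i\<in>I. f i) = (\<Sum>i\<in>I. (M :: complex ^ 'n::finite ^ 'm) *v f i)"
  by (induction I rule: infinite_finite_induct) (simp_all add: matrix_vector_right_distrib)

lemma cadjoint_cadjoint [simp]: "cadjoint (cadjoint M) = M"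
  by (simp add: cadjoint_def vec_eq_iff)

lemma cadjoint_mult: "cadjoint (M ** N) = cadjoint N ** cadjoint M"
  by (simp add: cadjoint_def matrix_matrix_mult_def vec_eq_iff mult_ac)

lemma cinner_mult_left: "cinner (M *v x) y = cinner x (cadjoint M *v y)"
  by (simp add: cinner_mult_right)

lemma psd_0: "psd 0"
  by (simp add: psd_def)

lemma psd_add: "psd M \<Longrightarrow> psd N \<Longrightarrow> psd (M + N)"
  by (simp add: psd_def matrix_vector_mult_add_rdistrib cinner_add_right)

lemma psd_sum: "(\<And>i. i \<in> I \<Longrightarrow> psd (M i)) \<Longrightarrow> psd (\<Sum>i\<in>I. M i)"
  by (induction I rule: infinite_finite_induct) (auto intro: psd_0 psd_add)

lemma psd_mscale: "0 \<le> c \<Longrightarrow> psd M \<Longrightarrow> psd (mscale (complex_of_real c) M)"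
  by (simp add: psd_def mscale_mult_vec cinner_scale_right)

lemma cinner_proj: "cinner y (proj x *v y) = complex_of_real ((cmod (cinner x y))\<^sup>2)"
  by (simp add: proj_eq_outer outer_mult_vec cinner_scale_right complex_norm_square
      cnj_cinner[of x y, symmetric] del: of_real_power)

lemma psd_proj: "psd (proj x)"
  unfolding psd_def cinner_proj by simp

section \<open>Spectral decomposition by deflation\<close>

lemma cinner_orthonormal_sum:
  assumes "orthonormal k y" "i < k"
  shows "cinner (y i) (\<Sum>j<k. c j *s y j) = c i"
proof -
  have "cinner (y i) (\<Sum>j<k. c j *s y j) = (\<Sum>j<k. if j = i then c j else 0)"
    unfolding cinner_sum_right
    by (intro sum.cong refl) (use assms in \<open>auto simp: cinner_scale_right orthonormal_def\<close>)
  then show ?thesis using assms(2) by simp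
qed

text \<open>Inner products isolate the coefficients of a vanishing combination, so the family is
  linearly independent. The bound makes the deflation in \<open>psd_spectral_aux\<close>
  terminate.\<close>

lemma orthonormal_card_le:
  fixes y :: "nat \<Rightarrow> complex ^ 'n::finite"
  assumes "orthonormal k y"
  shows "k \<le> CARD('n)"
proof -
  have inj: "inj_on y {..<k}"
  proof (rule inj_onI)
    fix i j assume "i \<in> {..<k}" "j \<in> {..<k}" "y i = y j"
    then show "i = j"
      using assms unfolding orthonormal_def by (metis lessThan_iff zero_neq_one)
  qed
  have "vec.independent (y ` {..<k})"
  proof (rule vec.independent_if_scalars_zero)
    fix f x assume s: "(\<Sum>x\<in>y ` {..<k}. f x *s x) = 0" and "x \<in> y ` {..<k}"
    then obtain i where i: "i < k" "x = y i" by auto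
    have "cinner (y i) (\<Sum>j<k. f (y j) *s y j) = 0"
      using s by (simp add: sum.reindex[OF inj])
    then show "f x = 0" using cinner_orthonormal_sum[OF assms i(1), of "\<lambda>j. f (y j)"] i by simp
  qed auto
  then have "card (y ` {..<k}) \<le> vec.dim (UNIV :: (complex ^ 'n) set)"
    by (intro vec.independent_card_le_dim) auto
  then show ?thesis using card_image[OF inj] by (simp add: vec.dim_UNIV card_cart_basis)
qed

lemma continuous_cinner_mult_vec:
  "continuous_on S (\<lambda>x. cinner x (M *v x))"
  unfolding cinner_def matrix_vector_mult_def by (simp, intro continuous_intros)

lemma norm_scale: "norm (c *s (x :: complex ^ 'n::finite)) = cmod c * norm x"
  by (simp add: norm_vec_def L2_set_def norm_mult power_mult_distrib flip: sum_distrib_left)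
    (simp add: real_sqrt_mult)

text \<open>The form attains its maximum \<open>l\<close> on the compact unit sphere at some
  \<open>e\<close>. Then \<open>l\<close> times the identity minus \<open>M\<close> is positive with
  zero expectation at \<open>e\<close>, and \<open>psd_kernel\<close> turns this into the eigenvalue
  equation.\<close>

lemma psd_top_eigenvector:
  fixes M :: "complex ^ 'n::finite ^ 'n"
  assumes "psd M" "M \<noteq> 0"
  obtains e l where "cinner e e = 1" "0 < l" "M *v e = complex_of_real l *s e"
proof -
  let ?q = "\<lambda>x. Re (cinner x (M *v x))"
  have q: "cinner x (M *v x) = complex_of_real (?q x)" "0 \<le> ?q x" for x
    using assms(1) by (auto simp: psd_def complex_nonneg_Reals_iff complex_eq_iff)
  have "norm (axis undefined 1 :: complex ^ 'n) = 1" by simp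
  then have "(sphere 0 1 :: (complex ^ 'n) set) \<noteq> {}" by (metis empty_iff mem_sphere_0)
  moreover have "continuous_on (sphere 0 1) ?q"
    by (intro continuous_intros continuous_cinner_mult_vec)
  ultimately obtain e where e: "norm e = 1" "\<And>x. norm x = 1 \<Longrightarrow> ?q x \<le> ?q e"
    using continuous_attains_sup[of "sphere 0 1" ?q] by auto
  define l where "l = ?q e"
  have le: "?q x \<le> l * (norm x)\<^sup>2" for x
  proof (cases "x = 0")
    case False
    define z where "z = complex_of_real (1 / norm x) *s x"
    have "norm z = 1" using False by (simp add: z_def norm_scale norm_divide)
    then have "?q z \<le> l" unfolding l_def by (rule e(2))
    moreover have "?q z = ?q x / (norm x)\<^sup>2"
      by (simp add: z_def vector_scalar_commute cinner_scale_left cinner_scale_right power2_eq_square)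
    ultimately show ?thesis using False by (simp add: field_simps)
  qed simp
  have "psd (mscale (complex_of_real l) (mat 1) - M)"
    unfolding psd_def
  proof
    fix x
    have eq: "cinner x ((mscale (complex_of_real l) (mat 1) - M) *v x) =
        complex_of_real (l * (norm x)\<^sup>2 - ?q x)"
      by (simp add: matrix_vector_mult_diff_rdistrib mscale_mult_vec cinner_diff_right
          cinner_scale_right cinner_self_norm q(1)[symmetric])
    then show "cinner x ((mscale (complex_of_real l) (mat 1) - M) *v x) \<in> \<real>\<^sub>\<ge>\<^sub>0"
      unfolding eq nonneg_Reals_of_real_iff using le[of x] by simp
  qed
  moreover have "cinner e ((mscale (complex_of_real l) (mat 1) - M) *v e) = 0"
    using e(1) q(1)[of e]
    by (simp add: matrix_vector_mult_diff_rdistrib mscale_mult_vec cinner_diff_right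
        cinner_scale_right cinner_self_norm l_def)
  ultimately have "(mscale (complex_of_real l) (mat 1) - M) *v e = 0"
    by (rule psd_kernel)
  then have ev: "M *v e = complex_of_real l *s e"
    by (simp add: matrix_vector_mult_diff_rdistrib mscale_mult_vec)
  have "l \<noteq> 0"
  proof
    assume "l = 0"
    then have "cinner x (M *v x) = 0" for x using le[of x] q[of x] by simp
    then have "M *v x = 0" for x using assms(1) psd_kernel by blast
    then have "M = 0" by (simp add: matrix_eq)
    then show False using assms(2) by simp
  qed
  then have "0 < l" using q(2)[of e] by (simp add: l_def)
  then show ?thesis using that[of e l] ev e(1) by (simp add: cinner_self_norm)
qed

text \<open>The new operator is Hermitian and kills \<open>e\<close>, so its form at
  \<open>z\<close> is that at the component \<open>w\<close> orthogonal to \<open>e\<close>, where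
  it agrees with the form of \<open>M\<close>.\<close>

lemma psd_deflate:
  assumes M: "psd M" and e: "cinner e e = 1" "M *v e = complex_of_real l *s e"
  shows "psd (M - mscale (complex_of_real l) (proj e))" (is "psd ?M'")
  unfolding psd_def
proof
  fix z
  have h: "cadjoint ?M' = ?M'"
    using psd_hermitian[OF M]
    by (simp add: cadjoint_def mscale_def map_matrix_def proj_def vec_eq_iff mult_ac)
  have v: "?M' *v x = M *v x - (complex_of_real l * cinner e x) *s e" for x
    by (simp add: matrix_vector_mult_diff_rdistrib mscale_mult_vec proj_eq_outer outer_mult_vec)
  have 0: "?M' *v e = 0" using e by (simp add: v)
  define w where "w = z - cinner e z *s e"
  have ew: "cinner e w = 0" using e by (simp add: w_def cinner_diff_right cinner_scale_right)
  have z: "z = w + cinner e z *s e" by (simp add: w_def)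
  have Mz: "?M' *v z = ?M' *v w"
    by (subst z) (simp add: matrix_vector_right_distrib vector_scalar_commute 0)
  have "cinner z (?M' *v z) = cinner (?M' *v z) w"
    unfolding Mz cinner_mult_right h ..
  also have "\<dots> = cinner w (?M' *v w)"
    unfolding Mz using cinner_mult_left[of ?M' w w] h by simp
  also have "\<dots> = cinner w (M *v w)" using ew by (simp add: v)
  also have "\<dots> \<in> \<real>\<^sub>\<ge>\<^sub>0" using M by (simp add: psd_def)
  finally show "cinner z (?M' *v z) \<in> \<real>\<^sub>\<ge>\<^sub>0" .
qed

text \<open>The \<open>y i\<close> with \<open>i < k\<close> are the vectors already split off; they
  lie in the kernel of what remains. The induction runs on the number of dimensions left and
  collects nonzero eigenvalues only.\<close>

lemma psd_spectral_aux:
  fixes M :: "complex ^ 'n::finite ^ 'n"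
  assumes "psd M" "orthonormal k y" "\<And>i. i < k \<Longrightarrow> M *v y i = 0"
  shows "\<exists>k' y' l. k \<le> k' \<and> orthonormal k' y' \<and> (\<forall>i. k \<le> i \<longrightarrow> 0 < l i) \<and>
    (\<forall>i<k. y' i = y i) \<and> M = (\<Sum>i=k..<k'. mscale (complex_of_real (l i)) (proj (y' i)))"
  using assms
proof (induction "CARD('n) - k" arbitrary: k y M rule: less_induct)
  case less
  show ?case
  proof (cases "M = 0")
    case True
    then show ?thesis using less.prems(2) by (intro exI[of _ k] exI[of _ y] exI[of _ "\<lambda>_. 1"]) simp
  next
    case False
    obtain e l where e: "cinner e e = 1" "0 < l" "M *v e = complex_of_real l *s e"
      using psd_top_eigenvector[OF less.prems(1) False] by blast
    define M' where "M' = M - mscale (complex_of_real l) (proj e)"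
    define y1 where "y1 = y(k := e)"
    \<comment> \<open>Kernel vectors are orthogonal to an eigenvector with nonzero eigenvalue, since
      \<open>M\<close> is Hermitian.\<close>
    have ye: "cinner (y i) e = 0" "cinner e (y i) = 0" if "i < k" for i
    proof -
      have "complex_of_real l * cinner (y i) e = cinner (M *v y i) e"
        using e(3) psd_hermitian[OF less.prems(1)]
        by (simp add: cinner_mult_left cinner_scale_right)
      then show "cinner (y i) e = 0" using less.prems(3)[OF that] e(2) by simp
      then show "cinner e (y i) = 0" using cnj_cinner[of "y i" e] by simp
    qed
    have on: "orthonormal (Suc k) y1"
      using less.prems(2) ye e(1) by (auto simp: orthonormal_def y1_def less_Suc_eq)
    have v: "M' *v x = M *v x - (complex_of_real l * cinner e x) *s e" for x
      by (simp add: M'_def matrix_vector_mult_diff_rdistrib mscale_mult_vec proj_eq_outer outer_mult_vec)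
    have ker: "M' *v y1 i = 0" if "i < Suc k" for i
      using that less.prems(3) ye e by (auto simp: v y1_def less_Suc_eq)
    have psd': "psd M'" unfolding M'_def by (rule psd_deflate) (use less.prems e in auto)
    have "CARD('n) - Suc k < CARD('n) - k"
      using orthonormal_card_le[OF on] by simp
    from less.hyps[OF this psd' on ker] obtain k' y' l' where *: "Suc k \<le> k'" "orthonormal k' y'"
      "\<And>i. Suc k \<le> i \<Longrightarrow> 0 < l' i"
      "M' = (\<Sum>i=Suc k..<k'. mscale (complex_of_real (l' i)) (proj (y' i)))" "\<And>i. i < Suc k \<Longrightarrow> y' i = y1 i"
      by blast
    have kk: "k < k'" using *(1) by simp
    have "M = mscale (complex_of_real l) (proj e) + M'" by (simp add: M'_def)
    also have "\<dots> = mscale (complex_of_real ((l'(k := l)) k)) (proj (y' k)) +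
        (\<Sum>i=Suc k..<k'. mscale (complex_of_real ((l'(k := l)) i)) (proj (y' i)))"
      unfolding *(4) using *(5)[of k] by (simp add: y1_def)
    also have "\<dots> = (\<Sum>i=k..<k'. mscale (complex_of_real ((l'(k := l)) i)) (proj (y' i)))"
      by (rule sum.atLeast_Suc_lessThan[OF kk, symmetric])
    finally show ?thesis
      using * kk e(2)
      by (intro exI[of _ k'] exI[of _ y'] exI[of _ "l'(k := l)"]) (auto simp: y1_def)
  qed
qed

lemma psd_spectral:
  assumes "psd M"
  obtains k y l where "orthonormal k y" "\<And>i. 0 < l i"
    "M = (\<Sum>i<k. mscale (complex_of_real (l i)) (proj (y i)))"
proof -
  obtain k y l where "orthonormal k y" "\<And>i. 0 < l i"
    "M = (\<Sum>i=0..<k. mscale (complex_of_real (l i)) (proj (y i)))"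
    using psd_spectral_aux[OF assms, of 0] by (auto simp: orthonormal_def)
  then show ?thesis by (intro that[of k y l]) (simp_all add: atLeast0LessThan)
qed

section \<open>Square roots and singular values\<close>

lemma spectral_mult_vec:
  "(\<Sum>i<k. mscale (c i) (proj (y i))) *v x = (\<Sum>i<k. (c i * cinner (y i) x) *s y i)"
  by (simp add: sum_mult_vec mscale_mult_vec proj_eq_outer outer_mult_vec)

text \<open>\<open>psd_sqrt\<close> is a definite description with uniqueness given by
  \<open>psd_sqrt_unique\<close>; existence comes from taking roots of the eigenvalues in a spectral
  decomposition.\<close>

lemma
  assumes "psd M"
  shows psd_psd_sqrt: "psd (psd_sqrt M)" and psd_sqrt_square: "psd_sqrt M ** psd_sqrt M = M"
proof -
  obtain k y l where y: "orthonormal k y" and l: "\<And>i. 0 < l i"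
    and M: "M = (\<Sum>i<k. mscale (complex_of_real (l i)) (proj (y i)))"
    using psd_spectral[OF assms] by blast
  define Q where "Q = (\<Sum>i<k. mscale (complex_of_real (sqrt (l i))) (proj (y i)))"
  have Q: "psd Q" unfolding Q_def by (intro psd_sum psd_mscale psd_proj) (simp add: l less_imp_le)
  have "Q ** Q = M"
    unfolding matrix_eq
  proof
    fix x
    have "cinner (y i) (Q *v x) = complex_of_real (sqrt (l i)) * cinner (y i) x" if "i < k" for i
      unfolding Q_def spectral_mult_vec by (rule cinner_orthonormal_sum[OF y that])
    moreover have "complex_of_real (sqrt (l i)) * complex_of_real (sqrt (l i)) = complex_of_real (l i)" for i
      using l[of i] by (simp flip: of_real_mult)
    ultimately have "(Q ** Q) *v x = (\<Sum>i<k. (complex_of_real (l i) * cinner (y i) x) *s y i)"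
      unfolding matrix_vector_mul_assoc[symmetric]
      by (subst (1) Q_def, subst spectral_mult_vec, intro sum.cong refl) (simp flip: mult.assoc)
    then show "(Q ** Q) *v x = M *v x" unfolding M spectral_mult_vec .
  qed
  then have "psd_sqrt M = Q" using psd_sqrt_eq[OF Q] by simp
  then show "psd (psd_sqrt M)" "psd_sqrt M ** psd_sqrt M = M" using Q \<open>Q ** Q = M\<close> by auto
qed

lemma psd_gram: "psd (cadjoint N ** N)"
proof -
  have "cinner x ((cadjoint N ** N) *v x) = cinner (N *v x) (N *v x)" for x
    unfolding matrix_vector_mul_assoc[symmetric] cinner_mult_right[of x "cadjoint N"] by simp
  then show ?thesis unfolding psd_def cinner_self_norm by simp
qed

lemma matrix_cinner_ext:
  assumes "\<And>x y. cinner x (M *v y) = cinner x (N *v y)" shows "M = N"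
proof -
  have "cinner (M *v y - N *v y) (M *v y - N *v y) = 0" for y
    using assms by (subst cinner_diff_right) simp
  then show ?thesis by (simp add: matrix_eq)
qed

text \<open>The \<open>y i\<close> are eigenvectors of the Gram matrix for its nonzero eigenvalues,
  the \<open>s i\<close> are the roots of these, and \<open>x i\<close> normalizes
  \<open>N *v y i\<close>. The squared Frobenius norm is the trace of the Gram matrix, hence the sum
  of its eigenvalues.\<close>

lemma singular_value_decomposition:
  fixes N :: "complex ^ 'n::finite ^ 'm::finite"
  obtains k x y s where "orthonormal k x" "orthonormal k y" "\<And>i. 0 < s i"
    "\<And>i. i < k \<Longrightarrow> N *v y i = complex_of_real (s i) *s x i"
    "(\<Sum>a\<in>UNIV. \<Sum>b\<in>UNIV. (cmod (N $ a $ b))\<^sup>2) = (\<Sum>i<k. (s i)\<^sup>2)"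
proof -
  let ?G = "cadjoint N ** N"
  obtain k y l where y: "orthonormal k y" and l: "\<And>i. 0 < l i"
    and G: "?G = (\<Sum>i<k. mscale (complex_of_real (l i)) (proj (y i)))"
    using psd_spectral[OF psd_gram[of N]] by blast
  define s where "s i = sqrt (l i)" for i
  have s: "0 < s i" "complex_of_real (s i) * complex_of_real (s i) = complex_of_real (l i)" for i
    using l[of i] by (auto simp: s_def simp flip: of_real_mult)
  define x where "x i = complex_of_real (1 / s i) *s (N *v y i)" for i
  have Nx: "N *v y i = complex_of_real (s i) *s x i" for i
    using s(1)[of i] by (simp add: x_def vec_eq_iff)
  have yy: "cinner (y i) (y j) = (if i = j then 1 else 0)" if "i < k" "j < k" for i j
    using y that by (simp add: orthonormal_def)
  have "cinner (N *v y i) (N *v y j) = (if i = j then complex_of_real (l i) else 0)"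
    if ij: "i < k" "j < k" for i j
  proof -
    have "cinner (N *v y i) (N *v y j) = cinner (y i) (?G *v y j)"
      unfolding cinner_mult_left by (simp add: matrix_vector_mul_assoc)
    also have "\<dots> = complex_of_real (l i) * cinner (y i) (y j)"
      unfolding G spectral_mult_vec by (rule cinner_orthonormal_sum[OF y ij(1)])
    finally show ?thesis using yy[OF ij] by simp
  qed
  moreover have "s i \<noteq> 0" for i using s(1)[of i] by simp
  ultimately have x: "orthonormal k x"
    by (auto simp: orthonormal_def x_def cinner_scale_left cinner_scale_right simp flip: s(2))
  have "(\<Sum>a\<in>UNIV. \<Sum>b\<in>UNIV. (cmod (N $ a $ b))\<^sup>2) = Re (trace ?G)"
  proof -
    have "Re (trace ?G) = (\<Sum>b\<in>UNIV. \<Sum>a\<in>UNIV. Re (cnj (N $ a $ b) * N $ a $ b))"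
      by (simp add: trace_def matrix_matrix_mult_def cadjoint_def)
    also have "\<dots> = (\<Sum>b\<in>UNIV. \<Sum>a\<in>UNIV. (cmod (N $ a $ b))\<^sup>2)"
      by (intro sum.cong refl) (simp add: cmod_power2, simp add: power2_eq_square)
    also have "\<dots> = (\<Sum>a\<in>UNIV. \<Sum>b\<in>UNIV. (cmod (N $ a $ b))\<^sup>2)" by (rule sum.swap)
    finally show ?thesis by simp
  qed
  also have "trace ?G = (\<Sum>i<k. complex_of_real (l i) * cinner (y i) (y i))"
  proof -
    have "trace ?G = (\<Sum>a\<in>UNIV. \<Sum>i<k. complex_of_real (l i) * (y i $ a * cnj (y i $ a)))"
      unfolding G by (simp add: trace_def mscale_def map_matrix_def proj_def)
    also have "\<dots> = (\<Sum>i<k. \<Sum>a\<in>UNIV. complex_of_real (l i) * (y i $ a * cnj (y i $ a)))"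
      by (rule sum.swap)
    finally show ?thesis by (simp add: cinner_def sum_distrib_left mult_ac)
  qed
  also have "Re \<dots> = (\<Sum>i<k. (s i)\<^sup>2)"
    using yy l by (simp add: s_def less_imp_le)
  finally show ?thesis using that[OF x y s(1) Nx] by blast
qed

section \<open>Fidelity with a pure state\<close>

lemma psd_sqrt_proj: "psd_sqrt (proj w) = mscale (complex_of_real (1 / norm w)) (proj w)" (is "_ = ?Q")
proof -
  have "?Q ** ?Q = proj w"
    unfolding matrix_eq
  proof
    fix x
    have "(?Q ** ?Q) *v x = (complex_of_real (1 / norm w * (1 / norm w) * (norm w)\<^sup>2) * cinner w x) *s w"
      unfolding matrix_vector_mul_assoc[symmetric]
      by (simp add: mscale_mult_vec proj_eq_outer outer_mult_vec vector_scalar_commute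
          cinner_scale_right cinner_self_norm mult_ac)
    \<comment> \<open>For \<open>w = 0\<close> the factor \<open>1 / norm w\<close> is 0 by
      convention, and both sides vanish.\<close>
    also have "\<dots> = cinner w x *s w"
      by (cases "w = 0") (auto simp: power2_eq_square)
    finally show "(?Q ** ?Q) *v x = proj w *v x" by (simp add: proj_eq_outer outer_mult_vec)
  qed
  moreover have "psd ?Q" by (intro psd_mscale psd_proj) simp
  ultimately show ?thesis using psd_sqrt_eq[of ?Q] by simp
qed

lemma trace_proj: "trace (proj w) = complex_of_real ((norm w)\<^sup>2)"
  unfolding cinner_self_norm[symmetric] by (simp add: trace_def proj_def cinner_def mult.commute)

lemma mult_proj_cadjoint: "M ** proj w ** cadjoint M = proj (M *v w)"
  unfolding matrix_eq matrix_vector_mul_assoc[symmetric]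
  by (simp add: proj_eq_outer outer_mult_vec vector_scalar_commute cinner_mult_left)

text \<open>The product of the two roots has the rank-one Gram matrix
  \<open>proj (?Q *v \<psi>)\<close>, so its trace norm is the length of
  \<open>?Q *v \<psi>\<close>. The value is linear in \<open>S\<close>, which both the Kraus
  expansion and the averaging over shared randomness use.\<close>

lemma fidelity_proj:
  assumes "psd S"
  shows "fidelity (proj \<psi>) S = Re (cinner \<psi> (S *v \<psi>))"
proof -
  let ?P = "psd_sqrt (proj \<psi>)" and ?Q = "psd_sqrt S"
  have h: "cadjoint ?P = ?P" "cadjoint ?Q = ?Q"
    using psd_psd_sqrt[OF assms] psd_psd_sqrt[OF psd_proj] psd_hermitian by auto
  have "cadjoint (?P ** ?Q) ** (?P ** ?Q) = ?Q ** (?P ** ?P) ** cadjoint ?Q"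
    by (simp add: cadjoint_mult h matrix_mul_assoc)
  also have "\<dots> = proj (?Q *v \<psi>)"
    by (simp add: psd_sqrt_square[OF psd_proj] mult_proj_cadjoint)
  finally have "trace_norm (?P ** ?Q) = Re (trace (psd_sqrt (proj (?Q *v \<psi>))))"
    by (simp add: trace_norm_def)
  also have "\<dots> = 1 / norm (?Q *v \<psi>) * Re (trace (proj (?Q *v \<psi>)))"
    by (simp add: psd_sqrt_proj trace_def mscale_def map_matrix_def sum_divide_distrib)
  also have "\<dots> = norm (?Q *v \<psi>)"
    by (simp add: trace_proj power2_eq_square)
  finally have "fidelity (proj \<psi>) S = Re (cinner (?Q *v \<psi>) (?Q *v \<psi>))"
    by (simp add: fidelity_def cinner_self_norm)
  also have "cinner (?Q *v \<psi>) (?Q *v \<psi>) = cinner \<psi> ((?Q ** ?Q) *v \<psi>)"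
    by (simp add: cinner_mult_left h matrix_vector_mul_assoc)
  finally show ?thesis by (simp add: psd_sqrt_square[OF assms])
qed


section \<open>Kraus operators\<close>

lemma sum_UNIV_prod:
  "(\<Sum>p\<in>UNIV. f p) = (\<Sum>i\<in>(UNIV :: 'a::finite set). \<Sum>j\<in>(UNIV :: 'b::finite set). f (i, j))"
  by (simp add: sum.cartesian_product)

lemma cinner_tensor_vec: "cinner (tensor_vec a b) (tensor_vec c d) = cinner a c * cinner b d"
  by (simp add: cinner_def tensor_vec_def sum_UNIV_prod sum_product mult_ac)

lemma tensor_mat_mult_vec: "tensor_mat X Y *v tensor_vec x y = tensor_vec (X *v x) (Y *v y)"
  by (simp add: tensor_mat_def tensor_vec_def matrix_vector_mult_def vec_eq_iff sum_UNIV_prod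
      sum_product mult_ac)

lemma matrix_eq_sum_unit_mat:
  fixes X :: "complex ^ 'n::finite ^ 'n"
  shows "X = (\<Sum>i\<in>UNIV. \<Sum>j\<in>UNIV. mscale (X $ i $ j) (unit_mat i j))"
  unfolding vec_eq_iff
proof safe
  fix a b
  have "(\<Sum>i\<in>UNIV. \<Sum>j\<in>UNIV. mscale (X $ i $ j) (unit_mat i j)) $ a $ b =
      (\<Sum>i\<in>UNIV. \<Sum>j\<in>UNIV. if j = b then if i = a then X $ i $ j else 0 else 0)"
    unfolding sum_component
    by (intro sum.cong refl) (auto simp: mscale_def map_matrix_def unit_mat_def)
  also have "\<dots> = X $ a $ b" by simp
  finally show "X $ a $ b = (\<Sum>i\<in>UNIV. \<Sum>j\<in>UNIV. mscale (X $ i $ j) (unit_mat i j)) $ a $ b" ..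
qed

lemma sum_in_nonneg_Reals: "(\<And>i. i \<in> I \<Longrightarrow> f i \<in> \<real>\<^sub>\<ge>\<^sub>0) \<Longrightarrow> sum f I \<in> \<real>\<^sub>\<ge>\<^sub>0"
  for f :: "'i \<Rightarrow> complex"
  by (induction I rule: infinite_finite_induct) auto

lemma linear_unit_mat_expansion:
  fixes E :: "complex ^ 'n::finite ^ 'n \<Rightarrow> complex ^ 'm ^ 'm"
  assumes "Vector_Spaces.linear mscale mscale E"
  shows "E X = (\<Sum>i\<in>UNIV. \<Sum>j\<in>UNIV. mscale (X $ i $ j) (E (unit_mat i j)))"
proof -
  interpret Vector_Spaces.linear mscale mscale E by fact
  show ?thesis by (subst matrix_eq_sum_unit_mat[of X]) (simp add: sum scale)
qed

definition kraus_map :: "'k set \<Rightarrow> ('k \<Rightarrow> complex ^ 'n ^ 'n::finite) \<Rightarrow> complex ^ 'n ^ 'n \<Rightarrow> complex ^ 'n ^ 'n" where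
  "kraus_map I K X = (\<Sum>c\<in>I. K c ** X ** cadjoint (K c))"

lemma kraus_map_entry:
  "kraus_map I K X $ a $ b = (\<Sum>c\<in>I. \<Sum>i\<in>UNIV. \<Sum>j\<in>UNIV. K c $ a $ i * X $ i $ j * cnj (K c $ b $ j))"
proof -
  have "(K c ** X ** cadjoint (K c)) $ a $ b =
      (\<Sum>i\<in>UNIV. \<Sum>j\<in>UNIV. K c $ a $ i * X $ i $ j * cnj (K c $ b $ j))" for c
    unfolding matrix_matrix_mult_def cadjoint_def
    by (simp add: sum_distrib_right) (rule sum.swap)
  then show ?thesis by (simp add: kraus_map_def)
qed

lemma kraus_map_unit_mat:
  "kraus_map I K (unit_mat i j) $ a $ b = (\<Sum>c\<in>I. K c $ a $ i * cnj (K c $ b $ j))"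
proof -
  have "(\<Sum>k\<in>UNIV. \<Sum>l\<in>UNIV. K c $ a $ k * unit_mat i j $ k $ l * cnj (K c $ b $ l)) =
      (\<Sum>k\<in>UNIV. \<Sum>l\<in>UNIV. if l = j then if k = i then K c $ a $ k * cnj (K c $ b $ l) else 0 else 0)" for c
    by (intro sum.cong refl) (simp add: unit_mat_def)
  then show ?thesis by (simp add: kraus_map_entry)
qed

lemma linear_kraus_map: "Vector_Spaces.linear mscale mscale (kraus_map I K)"
  unfolding Vector_Spaces.linear_def module_hom_def module_hom_axioms_def
  using vector_space_mscale[unfolded vector_space_def module_iff_vector_space[symmetric]]
  by (auto simp: vector_space_mscale module_iff_vector_space vec_eq_iff kraus_map_entry mscale_def
      map_matrix_def distrib_left distrib_right sum.distrib sum_distrib_left mult_ac)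

lemma trace_sum_mult:
  "trace ((\<Sum>c\<in>I. M c) ** X) = (\<Sum>c\<in>I. trace (M c ** (X :: complex ^ 'n::finite ^ 'n)))"
proof -
  have "trace ((\<Sum>c\<in>I. M c) ** X) = (\<Sum>a\<in>UNIV. \<Sum>b\<in>UNIV. \<Sum>c\<in>I. M c $ a $ b * X $ b $ a)"
    by (simp add: trace_def matrix_matrix_mult_def sum_distrib_right)
  also have "\<dots> = (\<Sum>c\<in>I. \<Sum>a\<in>UNIV. \<Sum>b\<in>UNIV. M c $ a $ b * X $ b $ a)"
    by (simp only: sum.swap[where B = I and A = UNIV])
  finally show ?thesis by (simp add: trace_def matrix_matrix_mult_def)
qed

lemma trace_kraus_map:
  assumes "(\<Sum>c\<in>I. cadjoint (K c) ** K c) = mat 1"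
  shows "trace (kraus_map I K X) = trace X"
proof -
  have "trace (kraus_map I K X) = (\<Sum>c\<in>I. trace (K c ** X ** cadjoint (K c)))"
    unfolding kraus_map_def trace_def sum_component by (rule sum.swap)
  also have "\<dots> = (\<Sum>c\<in>I. trace ((cadjoint (K c) ** K c) ** X))"
    by (intro sum.cong refl) (metis trace_mul_sym matrix_mul_assoc)
  also have "\<dots> = trace ((\<Sum>c\<in>I. cadjoint (K c) ** K c) ** X)"
    by (rule trace_sum_mult[symmetric])
  finally show ?thesis using assms by simp
qed

text \<open>The Kraus operators move over to the test vectors: the form of the image is a sum over
  \<open>c\<close> of forms of \<open>Y\<close> at the block vectors with entries
  \<open>cadjoint (K c) *v x p\<close>.\<close>

lemma completely_positive_kraus_map: "completely_positive (kraus_map I K)"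
  unfolding completely_positive_def
proof (intro allI impI)
  fix k Y assume Y: "block_psd k (Y :: nat \<Rightarrow> nat \<Rightarrow> complex ^ 'a ^ 'a)"
  show "block_psd k (\<lambda>p q. kraus_map I K (Y p q))"
    unfolding block_psd_def
  proof
    fix x :: "nat \<Rightarrow> complex ^ 'a"
    have "(\<Sum>p<k. \<Sum>q<k. cinner (x p) (kraus_map I K (Y p q) *v x q)) =
      (\<Sum>p<k. \<Sum>q<k. \<Sum>c\<in>I. cinner (cadjoint (K c) *v x p) (Y p q *v (cadjoint (K c) *v x q)))"
      by (simp add: kraus_map_def sum_mult_vec cinner_sum_right cinner_mult_left
          flip: matrix_vector_mul_assoc)
    also have "\<dots> = (\<Sum>c\<in>I. \<Sum>p<k. \<Sum>q<k. cinner (cadjoint (K c) *v x p) (Y p q *v (cadjoint (K c) *v x q)))"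
      by (simp only: sum.swap[where B = I and A = "{..<k}"])
    also have "\<dots> \<in> \<real>\<^sub>\<ge>\<^sub>0"
      by (rule sum_in_nonneg_Reals)
        (use Y[unfolded block_psd_def, rule_format, of "\<lambda>p. cadjoint (K c) *v x p" for c] in simp)
    finally show "(\<Sum>p<k. \<Sum>q<k. cinner (x p) (kraus_map I K (Y p q) *v x q)) \<in> \<real>\<^sub>\<ge>\<^sub>0" .
  qed
qed

lemma channel_kraus_map:
  assumes "(\<Sum>c\<in>I. cadjoint (K c) ** K c) = mat 1"
  shows "channel (kraus_map I K)"
  unfolding channel_def
  using linear_kraus_map completely_positive_kraus_map trace_kraus_map[OF assms] by blast

section \<open>The Choi matrix and Kraus forms of channels\<close>

definition choi :: "(complex ^ 'n ^ 'n \<Rightarrow> complex ^ 'n ^ 'n) \<Rightarrow> complex ^ ('n \<times> 'n) ^ ('n \<times> 'n)" where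
  "choi E = (\<chi> p q. E (unit_mat (fst p) (fst q)) $ snd p $ snd q)"

text \<open>The block matrix of all matrix units is the unnormalized maximally entangled state: its
  form is the squared modulus of a linear functional. Applying \<open>E\<close> to each block gives
  the Choi matrix.\<close>

lemma psd_choi:
  fixes E :: "complex ^ 'n::finite ^ 'n \<Rightarrow> complex ^ 'n ^ 'n"
  assumes "completely_positive E"
  shows "psd (choi E)"
  unfolding psd_def
proof
  fix x :: "complex ^ ('n \<times> 'n)"
  \<comment> \<open>The blocks in \<open>block_psd\<close> are numbered by naturals, so
    \<open>h\<close> numbers the basis.\<close>
  obtain h where h: "bij_betw h {..<CARD('n)} (UNIV :: 'n set)"
    using ex_bij_betw_nat_finite[of "UNIV :: 'n set"] by (auto simp: atLeast0LessThan)
  let ?k = "CARD('n)"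
  have "block_psd ?k (\<lambda>p q. unit_mat (h p) (h q))"
    unfolding block_psd_def
  proof
    fix z :: "nat \<Rightarrow> complex ^ 'n"
    have "cinner a (unit_mat i j *v b) = cnj (a $ i) * b $ j" for a b :: "complex ^ 'n" and i j
    proof -
      have "(unit_mat i j *v b) = (\<chi> k. if k = i then b $ j else 0)"
        by (auto simp: vec_eq_iff matrix_vector_mult_def unit_mat_def if_distrib[of "\<lambda>c. c * _"] cong: if_cong)
      then show ?thesis
        by (simp add: cinner_def if_distrib[of "\<lambda>c. _ * c"] cong: if_cong)
    qed
    then have "(\<Sum>p<?k. \<Sum>q<?k. cinner (z p) (unit_mat (h p) (h q) *v z q)) =
        cnj (\<Sum>p<?k. z p $ h p) * (\<Sum>p<?k. z p $ h p)"
      by (simp add: sum_product)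
    also have "\<dots> = complex_of_real ((cmod (\<Sum>p<?k. z p $ h p))\<^sup>2)"
      by (simp add: complex_norm_square mult.commute del: of_real_power)
    finally show "(\<Sum>p<?k. \<Sum>q<?k. cinner (z p) (unit_mat (h p) (h q) *v z q)) \<in> \<real>\<^sub>\<ge>\<^sub>0"
      by (simp del: of_real_power)
  qed
  then have pos: "block_psd ?k (\<lambda>p q. E (unit_mat (h p) (h q)))"
    using assms unfolding completely_positive_def by blast
  define z where "z i = (\<chi> a. x $ (i, a))" for i
  have "cinner x (choi E *v x) = (\<Sum>i\<in>UNIV. \<Sum>j\<in>UNIV. cinner (z i) (E (unit_mat i j) *v z j))"
  proof -
    have "cinner x (choi E *v x) = (\<Sum>i\<in>UNIV. \<Sum>a\<in>UNIV. \<Sum>j\<in>UNIV. \<Sum>b\<in>UNIV.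
        cnj (x $ (i, a)) * (E (unit_mat i j) $ a $ b * x $ (j, b)))"
      by (simp add: cinner_def matrix_vector_mult_def sum_UNIV_prod choi_def sum_distrib_left)
    also have "\<dots> = (\<Sum>i\<in>UNIV. \<Sum>j\<in>UNIV. \<Sum>a\<in>UNIV. \<Sum>b\<in>UNIV.
        cnj (x $ (i, a)) * (E (unit_mat i j) $ a $ b * x $ (j, b)))"
      by (intro sum.cong refl sum.swap)
    finally show ?thesis
      by (simp add: cinner_def matrix_vector_mult_def z_def sum_distrib_left)
  qed
  also have "\<dots> = (\<Sum>p<?k. \<Sum>q<?k. cinner (z (h p)) (E (unit_mat (h p) (h q)) *v z (h q)))"
    by (simp add: sum.reindex_bij_betw[OF h, symmetric])
  also have "\<dots> \<in> \<real>\<^sub>\<ge>\<^sub>0"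
    using pos unfolding block_psd_def by (rule spec)
  finally show "cinner x (choi E *v x) \<in> \<real>\<^sub>\<ge>\<^sub>0" .
qed

text \<open>The Choi matrix is its positive root times the adjoint of that root, and the columns of
  the root, reshaped into matrices, are Kraus operators; hence the index type of pairs. Trace
  preservation on matrix units gives the completeness relation.\<close>

lemma channel_kraus:
  fixes E :: "complex ^ 'n::finite ^ 'n \<Rightarrow> complex ^ 'n ^ 'n"
  assumes "channel E"
  obtains K :: "'n \<times> 'n \<Rightarrow> complex ^ 'n ^ 'n"
  where "E = kraus_map UNIV K" "(\<Sum>c\<in>UNIV. cadjoint (K c) ** K c) = mat 1"
proof -
  have lin: "Vector_Spaces.linear mscale mscale E" and psd: "psd (choi E)"
    and tr: "\<And>X. trace (E X) = trace X"
    using assms psd_choi by (auto simp: channel_def)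
  let ?Q = "psd_sqrt (choi E)"
  define K where "K c = (\<chi> a i. ?Q $ (i, a) $ c)" for c
  have unit: "E (unit_mat i j) $ a $ b = (\<Sum>c\<in>UNIV. K c $ a $ i * cnj (K c $ b $ j))" for i j a b
  proof -
    have "choi E = ?Q ** cadjoint ?Q"
      using psd_sqrt_square[OF psd] psd_hermitian[OF psd_psd_sqrt[OF psd]] by simp
    then have "choi E $ (i, a) $ (j, b) = (?Q ** cadjoint ?Q) $ (i, a) $ (j, b)" by simp
    then show ?thesis by (simp add: choi_def matrix_matrix_mult_def cadjoint_def K_def)
  qed
  have eq: "E = kraus_map UNIV K"
  proof
    fix X
    have "E (unit_mat i j) = kraus_map UNIV K (unit_mat i j)" for i j
      by (simp add: vec_eq_iff unit kraus_map_unit_mat)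
    then show "E X = kraus_map UNIV K X"
      using linear_unit_mat_expansion[OF lin, of X] linear_unit_mat_expansion[OF linear_kraus_map, of UNIV K X]
      by simp
  qed
  have "(\<Sum>c\<in>UNIV. cadjoint (K c) ** K c) $ j $ i = mat 1 $ j $ i" for i j
  proof -
    have "(\<Sum>c\<in>UNIV. cadjoint (K c) ** K c) $ j $ i = (\<Sum>c\<in>UNIV. \<Sum>a\<in>UNIV. K c $ a $ i * cnj (K c $ a $ j))"
      by (simp add: matrix_matrix_mult_def cadjoint_def mult.commute)
    also have "\<dots> = trace (E (unit_mat i j))"
      unfolding trace_def unit by (rule sum.swap)
    also have "\<dots> = mat 1 $ j $ i"
      unfolding tr by (cases "i = j") (auto simp: trace_def unit_mat_def mat_def intro!: sum.neutral)
    finally show ?thesis .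
  qed
  then have "(\<Sum>c\<in>UNIV. cadjoint (K c) ** K c) = mat 1" by (simp add: vec_eq_iff)
  with eq show ?thesis by (rule that)
qed

section \<open>Outputs of product channels\<close>

lemma tensor_map_kraus_map:
  fixes K :: "'k \<Rightarrow> complex ^ 'a::finite ^ 'a" and L :: "'l \<Rightarrow> complex ^ 'b::finite ^ 'b"
  shows "tensor_map (kraus_map I K) (kraus_map J L) (proj \<phi>) =
    (\<Sum>c\<in>I. \<Sum>d\<in>J. proj (tensor_mat (K c) (L d) *v \<phi>))"
proof -
  have "tensor_map (kraus_map I K) (kraus_map J L) (proj \<phi>) $ p $ q =
    (\<Sum>c\<in>I. \<Sum>d\<in>J. proj (tensor_mat (K c) (L d) *v \<phi>)) $ p $ q" for p q
  proof -
    define A where "A c d x i k = K c $ fst x $ i * L d $ snd x $ k * \<phi> $ (i, k)" for c d x i k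
    have "tensor_map (kraus_map I K) (kraus_map J L) (proj \<phi>) $ p $ q =
      (\<Sum>i\<in>UNIV. \<Sum>j\<in>UNIV. \<Sum>k\<in>UNIV. \<Sum>l\<in>UNIV. \<Sum>d\<in>J. \<Sum>c\<in>I. A c d p i k * cnj (A c d q j l))"
      by (simp add: tensor_map_def mscale_def map_matrix_def tensor_mat_def kraus_map_unit_mat proj_def
          A_def sum_product sum_distrib_left mult_ac)
    also have "\<dots> = (\<Sum>d\<in>J. \<Sum>c\<in>I. \<Sum>i\<in>UNIV. \<Sum>j\<in>UNIV. \<Sum>k\<in>UNIV. \<Sum>l\<in>UNIV. A c d p i k * cnj (A c d q j l))"
      by (simp only: sum.swap[where B = I and A = UNIV] sum.swap[where B = J and A = UNIV])
    also have "\<dots> = (\<Sum>d\<in>J. \<Sum>c\<in>I. (\<Sum>i\<in>UNIV. \<Sum>k\<in>UNIV. A c d p i k) * cnj (\<Sum>j\<in>UNIV. \<Sum>l\<in>UNIV. A c d q j l))"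
      by (simp add: sum_product)
    also have "\<dots> = (\<Sum>c\<in>I. \<Sum>d\<in>J. (\<Sum>i\<in>UNIV. \<Sum>k\<in>UNIV. A c d p i k) * cnj (\<Sum>j\<in>UNIV. \<Sum>l\<in>UNIV. A c d q j l))"
      by (rule sum.swap)
    also have "\<dots> = (\<Sum>c\<in>I. \<Sum>d\<in>J. proj (tensor_mat (K c) (L d) *v \<phi>)) $ p $ q"
      by (simp add: proj_def matrix_vector_mult_def tensor_mat_def sum_UNIV_prod A_def)
    finally show ?thesis .
  qed
  then show ?thesis by (simp add: vec_eq_iff)
qed

lemma psd_tensor_map_kraus_map: "psd (tensor_map (kraus_map I K) (kraus_map J L) (proj \<phi>))"
  unfolding tensor_map_kraus_map by (intro psd_sum psd_proj)

lemma cmod_cinner_commute: "cmod (cinner x y) = cmod (cinner y x)"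
  by (metis cnj_cinner complex_mod_cnj)

text \<open>The output is a sum of rank-one terms, and \<open>fidelity_proj\<close> is linear in it.
  The right-hand side is the squared Frobenius norm of the amplitude matrix, to be expressed by
  singular values.\<close>

lemma fidelity_kraus_map:
  "fidelity (proj \<psi>) (tensor_map (kraus_map I K) (kraus_map J L) (proj \<phi>)) =
    (\<Sum>c\<in>I. \<Sum>d\<in>J. (cmod (cinner \<psi> (tensor_mat (K c) (L d) *v \<phi>)))\<^sup>2)"
proof -
  have "fidelity (proj \<psi>) (tensor_map (kraus_map I K) (kraus_map J L) (proj \<phi>)) =
    (\<Sum>c\<in>I. \<Sum>d\<in>J. (cmod (cinner (tensor_mat (K c) (L d) *v \<phi>) \<psi>))\<^sup>2)"
    by (subst fidelity_proj[OF psd_tensor_map_kraus_map], unfold tensor_map_kraus_map)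
      (simp add: sum_mult_vec cinner_sum_right cinner_proj del: of_real_power)
  then show ?thesis by (metis (no_types, lifting) cmod_cinner_commute sum.cong)
qed

section \<open>Averages over shared randomness\<close>

lemma cinner_scaleR_mult_vec: "cinner x ((a *\<^sub>R M) *v y) = a *\<^sub>R cinner x (M *v y)"
  by (simp add: cinner_def matrix_vector_mult_def scaleR_sum_right sum_distrib_left)

text \<open>This lets the Bochner integral pass through expectation values. The parts are separate
  because positivity asks for a nonnegative real and a vanishing imaginary part.\<close>

lemma bounded_linear_expectation:
  "bounded_linear (\<lambda>M. Re (cinner x ((M :: complex ^ 'n::finite ^ 'n) *v x)))"
  "bounded_linear (\<lambda>M. Im (cinner x ((M :: complex ^ 'n::finite ^ 'n) *v x)))"
proof -
  have "linear (\<lambda>M. cinner x ((M :: complex ^ 'n ^ 'n) *v x))"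
    by (intro linearI)
      (simp_all add: matrix_vector_mult_add_rdistrib cinner_add_right cinner_scaleR_mult_vec)
  then have *: "bounded_linear (\<lambda>M. cinner x ((M :: complex ^ 'n ^ 'n) *v x))"
    by (simp add: linear_conv_bounded_linear)
  show "bounded_linear (\<lambda>M. Re (cinner x ((M :: complex ^ 'n ^ 'n) *v x)))"
    "bounded_linear (\<lambda>M. Im (cinner x ((M :: complex ^ 'n ^ 'n) *v x)))"
    using bounded_linear_compose[OF bounded_linear_Re *] bounded_linear_compose[OF bounded_linear_Im *]
    by auto
qed

lemma psd_integral:
  fixes f :: "'l \<Rightarrow> complex ^ 'n::finite ^ 'n"
  assumes "integrable \<mu> f" "\<And>l. l \<in> space \<mu> \<Longrightarrow> psd (f l)"
  shows "psd (\<integral>l. f l \<partial>\<mu>)"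
  unfolding psd_def
proof
  fix x
  have "0 \<le> (\<integral>l. Re (cinner x (f l *v x)) \<partial>\<mu>)"
    by (intro Bochner_Integration.integral_nonneg)
      (use assms(2) in \<open>auto simp: psd_def complex_nonneg_Reals_iff\<close>)
  moreover have "(\<integral>l. Im (cinner x (f l *v x)) \<partial>\<mu>) = (\<integral>l. 0 \<partial>\<mu>)"
    by (intro Bochner_Integration.integral_cong refl)
      (use assms(2) in \<open>auto simp: psd_def complex_nonneg_Reals_iff\<close>)
  ultimately show "cinner x ((\<integral>l. f l \<partial>\<mu>) *v x) \<in> \<real>\<^sub>\<ge>\<^sub>0"
    using integral_bounded_linear[OF bounded_linear_expectation(1) assms(1), of x]
      integral_bounded_linear[OF bounded_linear_expectation(2) assms(1), of x]
    by (simp add: complex_nonneg_Reals_iff)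
qed

text \<open>Linearity makes the fidelity of the average the average of the fidelities, and a mean
  cannot exceed a common bound of the values.\<close>

lemma fidelity_proj_integral_le:
  fixes f :: "'l \<Rightarrow> complex ^ 'n::finite ^ 'n"
  assumes "prob_space \<mu>" "integrable \<mu> f" "\<And>l. l \<in> space \<mu> \<Longrightarrow> psd (f l)"
    and "\<And>l. l \<in> space \<mu> \<Longrightarrow> fidelity (proj \<psi>) (f l) \<le> C"
  shows "fidelity (proj \<psi>) (\<integral>l. f l \<partial>\<mu>) \<le> C"
proof -
  interpret prob_space \<mu> by fact
  have i: "integrable \<mu> (\<lambda>l. Re (cinner \<psi> (f l *v \<psi>)))"
    by (rule integrable_bounded_linear[OF bounded_linear_expectation(1) assms(2)])
  have "fidelity (proj \<psi>) (\<integral>l. f l \<partial>\<mu>) = (\<integral>l. Re (cinner \<psi> (f l *v \<psi>)) \<partial>\<mu>)"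
    using integral_bounded_linear[OF bounded_linear_expectation(1) assms(2), of \<psi>]
    by (simp add: fidelity_proj[OF psd_integral[OF assms(2,3)]])
  also have "\<dots> \<le> (\<integral>l. C \<partial>\<mu>)"
    by (rule integral_mono[OF i]) (use assms(3,4) in \<open>auto simp flip: fidelity_proj\<close>)
  finally show ?thesis by (simp add: prob_space)
qed


section \<open>Rearrangement and the classical side\<close>

text \<open>A relation rather than a function, since ties leave several such enumerations.\<close>

definition decreasing_enumeration :: "'i set \<Rightarrow> ('i \<Rightarrow> real) \<Rightarrow> (nat \<Rightarrow> 'i) \<Rightarrow> bool" where
  "decreasing_enumeration S a e \<longleftrightarrow> bij_betw e {..<card S} S \<and>
     (\<forall>i j. i \<le> j \<and> j < card S \<longrightarrow> a (e j) \<le> a (e i))"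

lemma decreasing_enumeration_exists:
  assumes "finite S"
  obtains e where "decreasing_enumeration S a e"
proof -
  obtain xs where xs: "set xs = S" "distinct xs" using finite_distinct_list[OF assms] by blast
  define ys where "ys = sort_key (\<lambda>x. - a x) xs"
  have ys: "set ys = S" "distinct ys" "length ys = card S"
    using xs distinct_card[of xs] by (auto simp: ys_def)
  have "sorted (map (\<lambda>x. - a x) ys)" by (simp add: ys_def)
  then have "a (ys ! j) \<le> a (ys ! i)" if "i \<le> j" "j < card S" for i j
    using that ys(3) sorted_nth_mono[of "map (\<lambda>x. - a x) ys" i j] by simp
  moreover have "bij_betw (nth ys) {..<card S} S"
    using bij_betw_nth[of ys] ys by auto
  ultimately show ?thesis by (intro that[of "nth ys"]) (auto simp: decreasing_enumeration_def)
qed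

text \<open>All decreasing enumerations list one multiset of values in sorted order, so the choice
  among ties does not affect the result.\<close>

lemma decreasing_eq:
  assumes "decreasing_enumeration J f e" "k < card J"
  shows "decreasing J f k = f (e k)"
proof -
  let ?xs = "map (\<lambda>k. f (e k)) [0..<card J]"
  have b: "bij_betw e {..<card J} J" using assms(1) by (simp add: decreasing_enumeration_def)
  have "image_mset f (mset_set J) = image_mset f (image_mset e (mset_set {0..<card J}))"
    using b by (simp add: image_mset_mset_set bij_betw_def atLeast0LessThan)
  also have "\<dots> = mset ?xs" by (simp add: multiset.map_comp comp_def flip: mset_upt)
  finally have "image_mset f (mset_set J) = mset ?xs" .
  moreover have "sort ?xs = rev ?xs"
  proof (rule properties_for_sort)
    show "sorted (rev ?xs)"
      using assms(1) unfolding decreasing_enumeration_def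
      by (auto simp: sorted_rev_iff_nth_mono)
  qed simp
  ultimately have "sorted_list_of_multiset (image_mset f (mset_set J)) = rev ?xs"
    by (simp only: sorted_list_of_multiset_mset)
  then show ?thesis using assms(2) by (simp add: decreasing_def)
qed

text \<open>\<open>W\<close> is a fractional choice of at most \<open>l\<close> elements. After
  subtracting the threshold \<theta>, the \<open>l\<close>-th largest value, full weight is best on
  the first \<open>l\<close> positions and weight 0 on the rest.\<close>

lemma weighted_sum_le_enumeration:
  assumes e: "decreasing_enumeration S a e" and "finite S" "l \<le> card S"
    and W: "\<And>x. x \<in> S \<Longrightarrow> 0 \<le> W x" "\<And>x. x \<in> S \<Longrightarrow> W x \<le> 1" "sum W S \<le> real l"
    and a: "\<And>x. x \<in> S \<Longrightarrow> 0 \<le> a x"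
  shows "(\<Sum>x\<in>S. a x * W x) \<le> (\<Sum>j<l. a (e j))"
proof (cases l)
  case 0
  then have "sum W S = 0" using W by (intro antisym sum_nonneg) auto
  then have "\<forall>x\<in>S. W x = 0" using W(1) \<open>finite S\<close> by (simp add: sum_nonneg_eq_0_iff)
  then show ?thesis using 0 by simp
next
  case (Suc l')
  \<comment> \<open>Positions start at 0, so \<open>l' = l - 1\<close> is the last of the
    \<open>l\<close> best ones.\<close>
  define \<theta> where "\<theta> = a (e l')"
  have b: "bij_betw e {..<card S} S" using e by (simp add: decreasing_enumeration_def)
  have eS: "e j \<in> S" if "j < card S" for j using b that by (auto simp: bij_betw_def)
  have \<theta>: "0 \<le> \<theta>" unfolding \<theta>_def using Suc assms(3) by (intro a eS) simp
  have "(\<Sum>x\<in>S. a x * W x) = (\<Sum>x\<in>S. (a x - \<theta>) * W x) + \<theta> * sum W S"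
    by (simp add: sum_distrib_left left_diff_distrib sum_subtractf)
  also have "\<dots> \<le> (\<Sum>x\<in>S. (a x - \<theta>) * W x) + \<theta> * l"
    using W(3) \<theta> by (simp add: mult_left_mono)
  also have "(\<Sum>x\<in>S. (a x - \<theta>) * W x) = (\<Sum>j<card S. (a (e j) - \<theta>) * W (e j))"
    by (rule sum.reindex_bij_betw[OF b, symmetric])
  also have "\<dots> \<le> (\<Sum>j<card S. if j < l then a (e j) - \<theta> else 0)"
  proof (rule sum_mono)
    fix j assume j: "j \<in> {..<card S}"
    show "(a (e j) - \<theta>) * W (e j) \<le> (if j < l then a (e j) - \<theta> else 0)"
    proof (cases "j < l")
      case True
      then have "0 \<le> a (e j) - \<theta>"
        using e Suc assms(3) by (auto simp: \<theta>_def decreasing_enumeration_def)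
      then show ?thesis using True W(2)[OF eS] j by (simp add: mult_left_le)
    next
      case False
      then have "a (e j) - \<theta> \<le> 0"
        using e Suc j by (auto simp: \<theta>_def decreasing_enumeration_def)
      then show ?thesis using False W(1)[OF eS] j by (simp add: mult_nonpos_nonneg)
    qed
  qed
  also have "\<dots> = (\<Sum>j<l. a (e j) - \<theta>)"
    using assms(3) by (intro sum.mono_neutral_cong_right) auto
  finally show ?thesis by (simp add: sum_subtractf mult.commute)
qed

text \<open>Summation by parts: nonnegative partial sums of \<open>B - A\<close> stay nonnegative
  after weighting by a nonnegative decreasing sequence.\<close>

lemma Abel_sum_mono:
  fixes b A B :: "nat \<Rightarrow> real"
  assumes "\<And>l. l \<le> K \<Longrightarrow> sum A {..<l} \<le> sum B {..<l}"
    and "\<And>k. k < K \<Longrightarrow> 0 \<le> b k" "\<And>i j. i \<le> j \<Longrightarrow> j < K \<Longrightarrow> b j \<le> b i"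
  shows "(\<Sum>k<K. A k * b k) \<le> (\<Sum>k<K. B k * b k)"
proof -
  define d where "d k = B k - A k" for k
  have D: "0 \<le> sum d {..<l}" if "l \<le> K" for l
    using assms(1)[OF that] by (simp add: d_def sum_subtractf)
  \<comment> \<open>The constant \<open>c\<close> is left free so that the induction step can use
    \<open>b l\<close>, the least weight so far; \<open>c = 0\<close> is the case wanted.\<close>
  have "c * sum d {..<l} \<le> (\<Sum>k<l. d k * b k)"
    if "l \<le> K" "\<And>k. k < l \<Longrightarrow> c \<le> b k" for l c
    using that
  proof (induction l arbitrary: c)
    case (Suc l)
    have "c * sum d {..<Suc l} \<le> b l * sum d {..<Suc l}"
      using Suc.prems D[of "Suc l"] by (intro mult_right_mono) auto
    also have "\<dots> \<le> (\<Sum>k<Suc l. d k * b k)"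
      using Suc.IH[of "b l"] Suc.prems(1) assms(3) by (simp add: algebra_simps)
    finally show ?case .
  qed simp
  from this[of K 0] show ?thesis
    using assms(2) by (simp add: d_def left_diff_distrib sum_subtractf)
qed

text \<open>By Abel summation it suffices to compare partial sums over \<open>k < l\<close>. The
  sums of \<open>D x k\<close> over these \<open>k\<close> are weights between 0 and 1 of total at
  most \<open>l\<close>, so the \<open>l\<close> largest \<open>a x\<close> dominate.\<close>

lemma substochastic_sum_le:
  fixes b :: "nat \<Rightarrow> real"
  assumes "finite S" "K \<le> card S" and e: "decreasing_enumeration S a e"
    and a: "\<And>x. x \<in> S \<Longrightarrow> 0 \<le> a x"
    and b: "\<And>k. k < K \<Longrightarrow> 0 \<le> b k" "\<And>i j. i \<le> j \<Longrightarrow> j < K \<Longrightarrow> b j \<le> b i"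
    and D: "\<And>x k. x \<in> S \<Longrightarrow> k < K \<Longrightarrow> 0 \<le> D x k"
      "\<And>k. k < K \<Longrightarrow> (\<Sum>x\<in>S. D x k) \<le> 1" "\<And>x. x \<in> S \<Longrightarrow> (\<Sum>k<K. D x k) \<le> 1"
  shows "(\<Sum>x\<in>S. \<Sum>k<K. a x * b k * D x k) \<le> (\<Sum>k<K. a (e k) * b k)"
proof -
  have "(\<Sum>x\<in>S. \<Sum>k<K. a x * b k * D x k) = (\<Sum>k<K. \<Sum>x\<in>S. a x * b k * D x k)"
    by (rule sum.swap)
  also have "\<dots> = (\<Sum>k<K. (\<Sum>x\<in>S. a x * D x k) * b k)"
    unfolding sum_distrib_right by (simp add: mult_ac)
  also have "\<dots> \<le> (\<Sum>k<K. a (e k) * b k)"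
  proof (rule Abel_sum_mono)
    fix l assume l: "l \<le> K"
    have "(\<Sum>k<l. \<Sum>x\<in>S. a x * D x k) = (\<Sum>x\<in>S. a x * (\<Sum>k<l. D x k))"
      unfolding sum_distrib_left by (rule sum.swap)
    also have "\<dots> \<le> (\<Sum>k<l. a (e k))"
    proof (rule weighted_sum_le_enumeration[OF e assms(1)])
      show "l \<le> card S" using l assms(2) by simp
      show "0 \<le> (\<Sum>k<l. D x k)" if "x \<in> S" for x
        using l that by (intro sum_nonneg D) auto
      show "(\<Sum>k<l. D x k) \<le> 1" if "x \<in> S" for x
      proof -
        have "(\<Sum>k<l. D x k) \<le> (\<Sum>k<K. D x k)" using l that by (intro sum_mono2 D) auto
        also have "\<dots> \<le> 1" by (rule D(3)[OF that])
        finally show ?thesis .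
      qed
      have "(\<Sum>x\<in>S. \<Sum>k<l. D x k) = (\<Sum>k<l. \<Sum>x\<in>S. D x k)" by (rule sum.swap)
      also have "\<dots> \<le> (\<Sum>k<l. 1)" using l by (intro sum_mono D) auto
      finally show "(\<Sum>x\<in>S. \<Sum>k<l. D x k) \<le> real l" by simp
    qed (use a in auto)
    finally show "(\<Sum>k<l. \<Sum>x\<in>S. a x * D x k) \<le> (\<Sum>k<l. a (e k))" .
  qed (use b in auto)
  finally show ?thesis .
qed

text \<open>An injection is a doubly substochastic matrix with entries 0 and 1.\<close>

lemma injection_sum_le:
  fixes b :: "nat \<Rightarrow> real"
  assumes "finite S" "K \<le> card S" "decreasing_enumeration S a e"
    and "\<And>x. x \<in> S \<Longrightarrow> 0 \<le> a x"
    and "\<And>k. k < K \<Longrightarrow> 0 \<le> b k" "\<And>i j. i \<le> j \<Longrightarrow> j < K \<Longrightarrow> b j \<le> b i"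
    and h: "inj_on h {..<K}" "h ` {..<K} \<subseteq> S"
  shows "(\<Sum>k<K. a (h k) * b k) \<le> (\<Sum>k<K. a (e k) * b k)"
proof -
  let ?D = "\<lambda>x k. if x = h k then 1 else 0 :: real"
  have "(\<Sum>k<K. a (h k) * b k) = (\<Sum>k<K. \<Sum>x\<in>S. a x * b k * ?D x k)"
  proof (intro sum.cong refl)
    fix k assume "k \<in> {..<K}"
    then have "h k \<in> S" using h(2) by auto
    then show "a (h k) * b k = (\<Sum>x\<in>S. a x * b k * ?D x k)"
      using assms(1) by (simp add: if_distrib[of "\<lambda>c. _ * c"] cong: if_cong)
  qed
  also have "\<dots> = (\<Sum>x\<in>S. \<Sum>k<K. a x * b k * ?D x k)" by (rule sum.swap)
  also have "\<dots> \<le> (\<Sum>k<K. a (e k) * b k)"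
  proof (rule substochastic_sum_le[OF assms(1-6)])
    fix x
    have "(\<Sum>k<K. ?D x k) = real (card {k\<in>{..<K}. x = h k})"
      by (simp add: sum.If_cases Int_def)
    moreover have "card {k\<in>{..<K}. x = h k} \<le> 1"
      using h(1) by (auto simp: card_le_Suc0_iff_eq inj_on_def)
    ultimately show "(\<Sum>k<K. ?D x k) \<le> 1" by simp
  next
    fix k assume "k < K"
    then show "(\<Sum>x\<in>S. ?D x k) \<le> 1" using assms(1) by simp
  qed auto
  finally show ?thesis .
qed

section \<open>Scores of injections and the classical maximum\<close>

text \<open>
  The maximum of \<open>(\<Sum>k<K. sqrt (r (fst (g k)) * p (snd (g k)) * t k))\<^sup>2\<close> over all probability
  distributions \<open>p\<close>, attained when \<open>p s\<close> is proportional to the summand for \<open>s\<close>.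
\<close>

definition score :: "(nat \<Rightarrow> real) \<Rightarrow> (nat \<Rightarrow> real) \<Rightarrow> nat \<Rightarrow> (nat \<Rightarrow> nat \<times> nat) \<Rightarrow> real" where
  "score r t K g = (\<Sum>s\<in>snd ` g ` {..<K}.
     (\<Sum>k | k < K \<and> snd (g k) = s. sqrt (r (fst (g k)) * t k))\<^sup>2)"

lemma score_eq:
  assumes "finite N" "snd ` g ` {..<K} \<subseteq> N"
  shows "score r t K g = (\<Sum>s\<in>N. (\<Sum>k | k < K \<and> snd (g k) = s. sqrt (r (fst (g k)) * t k))\<^sup>2)"
  unfolding score_def
proof (rule sum.mono_neutral_left[OF assms], rule ballI)
  fix s assume "s \<in> N - snd ` g ` {..<K}"
  then have "{k. k < K \<and> snd (g k) = s} = {}" by auto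
  then show "(\<Sum>k | k < K \<and> snd (g k) = s. sqrt (r (fst (g k)) * t k))\<^sup>2 = 0"
    by (simp only: sum.empty power_zero_numeral)
qed

lemma score_nonneg: "0 \<le> score r t K g"
  unfolding score_def by (intro sum_nonneg) simp

lemma score_relabel:
  assumes "inj_on f (snd ` g ` {..<K})"
  shows "score r t K (\<lambda>k. (fst (g k), f (snd (g k)))) = score r t K g"
proof -
  have "snd ` (\<lambda>k. (fst (g k), f (snd (g k)))) ` {..<K} = f ` snd ` g ` {..<K}"
    by (auto simp: image_iff)
  then have "score r t K (\<lambda>k. (fst (g k), f (snd (g k)))) =
      (\<Sum>s\<in>snd ` g ` {..<K}. (\<Sum>k | k < K \<and> f (snd (g k)) = f s. sqrt (r (fst (g k)) * t k))\<^sup>2)"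
    unfolding score_def by (simp add: sum.reindex[OF assms])
  also have "\<dots> = score r t K g"
    unfolding score_def
  proof (intro sum.cong refl)
    fix s assume "s \<in> snd ` g ` {..<K}"
    then have "{k. k < K \<and> f (snd (g k)) = f s} = {k. k < K \<and> snd (g k) = s}"
      using inj_onD[OF assms] by blast
    then show "(\<Sum>k | k < K \<and> f (snd (g k)) = f s. sqrt (r (fst (g k)) * t k))\<^sup>2 =
        (\<Sum>k | k < K \<and> snd (g k) = s. sqrt (r (fst (g k)) * t k))\<^sup>2" by simp
  qed
  finally show ?thesis .
qed

lemma weighted_sum_eq:
  fixes K :: nat
  assumes "finite N" "snd ` g ` {..<K} \<subseteq> N"
  shows "(\<Sum>k<K. sqrt (r (fst (g k)) * p (snd (g k)) * t k)) =
    (\<Sum>s\<in>N. sqrt (p s) * (\<Sum>k | k < K \<and> snd (g k) = s. sqrt (r (fst (g k)) * t k)))"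
proof -
  have "(\<Sum>k<K. sqrt (r (fst (g k)) * p (snd (g k)) * t k)) =
      (\<Sum>s\<in>N. \<Sum>k | k \<in> {..<K} \<and> snd (g k) = s. sqrt (r (fst (g k)) * p (snd (g k)) * t k))"
    using assms by (intro sum.group[symmetric]) auto
  also have "\<dots> = (\<Sum>s\<in>N. sqrt (p s) * (\<Sum>k | k < K \<and> snd (g k) = s. sqrt (r (fst (g k)) * t k)))"
    by (simp add: sum_distrib_left real_sqrt_mult mult_ac)
  finally show ?thesis .
qed

text \<open>Cauchy-Schwarz between the \<open>sqrt (p s)\<close> and the inner sums, after grouping
  the indices \<open>k\<close> by letter.\<close>

lemma weighted_sum_le_score:
  assumes "finite N" "snd ` g ` {..<K} \<subseteq> N" "\<And>s. s \<in> N \<Longrightarrow> 0 \<le> p s"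
  shows "(\<Sum>k<K. sqrt (r (fst (g k)) * p (snd (g k)) * t k))\<^sup>2 \<le> sum p N * score r t K g"
proof -
  have sum_eq: "(\<Sum>s\<in>N. (sqrt (p s))\<^sup>2) = sum p N" using assms(3) by (intro sum.cong) auto
  show ?thesis
    unfolding weighted_sum_eq[OF assms(1,2)] score_eq[OF assms(1,2)]
    by (subst sum_eq[symmetric]) (rule Cauchy_Schwarz_ineq_sum)
qed

text \<open>The inverse of \<open>to_nat_on J\<close> already lists the embedded \<open>t\<close> in
  decreasing order, so its rearrangement is \<open>t\<close> padded by zeros, and positions from
  \<open>K\<close> on contribute nothing.\<close>

lemma classical_value_eq:
  assumes e: "decreasing_enumeration J f e" and "finite J" "K \<le> card J" "K \<le> m"
    and t: "\<And>i j. i \<le> j \<Longrightarrow> j < m \<Longrightarrow> t j \<le> t i" "\<And>k. k < m \<Longrightarrow> 0 \<le> t k"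
      "\<And>k. K \<le> k \<Longrightarrow> k < m \<Longrightarrow> t k = 0"
  shows "diag_fidelity {..<card J} (decreasing J f) (decreasing J (embed_diag J m t)) =
    (\<Sum>k<K. sqrt (f (e k) * t k))\<^sup>2"
proof -
  let ?e = "inv_into J (to_nat_on J)"
  have b: "bij_betw (to_nat_on J) J {..<card J}" using to_nat_on_finite[OF assms(2)] .
  have inv: "to_nat_on J (?e k) = k" if "k < card J" for k
    using bij_betw_inv_into_right[OF b] that by simp
  have "decreasing_enumeration J (embed_diag J m t) ?e"
    unfolding decreasing_enumeration_def
    using bij_betw_inv_into[OF b] t by (auto simp: embed_diag_def inv)
  then have T: "decreasing J (embed_diag J m t) k = (if k < m then t k else 0)" if "k < card J" for k
    using decreasing_eq[OF _ that] inv[OF that] by (simp add: embed_diag_def)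
  have "(\<Sum>k<card J. sqrt (decreasing J f k * decreasing J (embed_diag J m t) k)) =
      (\<Sum>k<K. sqrt (f (e k) * t k))"
    by (rule sum.mono_neutral_cong_right)
      (use assms decreasing_eq[OF e] T in \<open>auto simp: not_less\<close>)
  then show ?thesis by (simp add: diag_fidelity_def)
qed

text \<open>The functions are extensional to make the set finite, so that \<open>Max\<close> over it
  is meaningful.\<close>

definition injections :: "nat \<Rightarrow> nat \<Rightarrow> nat \<Rightarrow> (nat \<Rightarrow> nat \<times> nat) set" where
  "injections K n S = {g \<in> {..<K} \<rightarrow>\<^sub>E {..<n} \<times> {..<S}. inj_on g {..<K}}"

lemma injectionsD:
  assumes "g \<in> injections K n S"
  shows "inj_on g {..<K}" and "g ` {..<K} \<subseteq> {..<n} \<times> {..<S}"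
    and "snd ` g ` {..<K} \<subseteq> {..<S}"
    and "k < K \<Longrightarrow> fst (g k) < n" and "k < K \<Longrightarrow> snd (g k) < S"
proof -
  have g: "g k \<in> {..<n} \<times> {..<S}" if "k < K" for k
    using assms that unfolding injections_def by blast
  then show "g ` {..<K} \<subseteq> {..<n} \<times> {..<S}" by blast
  then show "snd ` g ` {..<K} \<subseteq> {..<S}" by auto
  show "inj_on g {..<K}" using assms by (simp add: injections_def)
  show "fst (g k) < n" "snd (g k) < S" if "k < K" using g[OF that] by (auto simp: mem_Times_iff)
qed

text \<open>For fixed \<open>p\<close> the sorted pairing is an injection, and Cauchy-Schwarz bounds
  its value by the score. Conversely, the equality case for the best injection gives a
  \<open>p\<close> whose value along that injection is \<open>C\<close>, and sorting can only
  increase it.\<close>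

lemma classical_fidelities_maximum:
  assumes t: "\<And>i j. i \<le> j \<Longrightarrow> j < m \<Longrightarrow> t j \<le> t i" "\<And>k. k < m \<Longrightarrow> 0 \<le> t k"
      "\<And>k. K \<le> k \<Longrightarrow> k < m \<Longrightarrow> t k = 0"
    and r: "\<And>i. i < n \<Longrightarrow> 0 \<le> r i" and "K \<le> m" "0 < n" "0 < S" "K \<le> n * S"
  defines "C \<equiv> Max (score r t K ` injections K n S)"
  shows "C \<in> classical_fidelities {..<S} n r m t"
    and "x \<in> classical_fidelities {..<S} n r m t \<Longrightarrow> x \<le> C"
    and "\<exists>g\<in>injections K n S. score r t K g = C"
    and "g \<in> injections K n S \<Longrightarrow> score r t K g \<le> C"
proof -
  let ?J = "{..<n} \<times> {..<S}"
  have J: "finite ?J" "K \<le> card ?J" using assms(8) by auto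
  have fin: "finite (injections K n S)"
    unfolding injections_def by (rule finite_subset[OF _ finite_PiE[of "{..<K}" "\<lambda>_. ?J"]]) auto
  \<comment> \<open>The first \<open>K\<close> positions of any enumeration of the grid form an
    injection.\<close>
  have res: "restrict e {..<K} \<in> injections K n S" if "decreasing_enumeration ?J f e" for e f
  proof -
    have b: "inj_on e {..<card ?J}" "e ` {..<card ?J} = ?J"
      using that unfolding decreasing_enumeration_def bij_betw_def by (simp_all only:)
    have sub: "{..<K} \<subseteq> {..<card ?J}" using J(2) by (simp only: lessThan_subset_iff)
    have "inj_on e {..<K}" by (rule inj_on_subset[OF b(1) sub])
    moreover have "e ` {..<K} \<subseteq> ?J" using image_mono[OF sub, of e] unfolding b(2) .
    ultimately show ?thesis
      unfolding injections_def mem_Collect_eq restrict_PiE_iff inj_on_restrict_eq by blast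
  qed
  obtain e where "decreasing_enumeration ?J (\<lambda>_. 0) e"
    using decreasing_enumeration_exists[OF J(1)] by blast
  then have ne: "injections K n S \<noteq> {}" using res by blast
  show ex: "\<exists>g\<in>injections K n S. score r t K g = C"
  proof -
    have "C \<in> score r t K ` injections K n S"
      unfolding C_def by (rule Max_in) (use fin ne in simp_all)
    then show ?thesis by (metis imageE)
  qed
  show le: "score r t K g \<le> C" if "g \<in> injections K n S" for g
    unfolding C_def using fin that by (intro Max_ge) auto
  define val where "val p = diag_fidelity {..<card ?J} (decreasing ?J (\<lambda>(i, s). r i * p s)) (decreasing ?J (embed_diag ?J m t))" for p
  have cf: "classical_fidelities {..<S} n r m t = val ` prob_dists {..<S}"
    unfolding classical_fidelities_def Let_def val_def Setcompr_eq_image ..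
  have attained: "\<exists>e. decreasing_enumeration ?J (\<lambda>(i, s). r i * p s) e \<and> val p =
      (\<Sum>k<K. sqrt (r (fst (e k)) * p (snd (e k)) * t k))\<^sup>2" for p
  proof -
    obtain e where e: "decreasing_enumeration ?J (\<lambda>(i, s). r i * p s) e"
      using decreasing_enumeration_exists[OF J(1)] by blast
    have "val p =
        (\<Sum>k<K. sqrt ((\<lambda>(i, s). r i * p s) (e k) * t k))\<^sup>2"
      unfolding val_def by (rule classical_value_eq[OF e J assms(5)]) (fact t)+
    then show ?thesis using e by (intro exI[of _ e] conjI) (simp_all only: case_prod_beta)
  qed
  show upper: "x \<le> C" if x_mem: "x \<in> classical_fidelities {..<S} n r m t" for x
  proof -
    obtain p where p: "p \<in> prob_dists {..<S}" and x: "x = val p"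
      using x_mem unfolding cf by blast
    obtain e where e: "decreasing_enumeration ?J (\<lambda>(i, s). r i * p s) e"
      and v: "val p = (\<Sum>k<K. sqrt (r (fst (e k)) * p (snd (e k)) * t k))\<^sup>2"
      using attained[of p] by blast
    let ?g = "restrict e {..<K}"
    have g: "?g \<in> injections K n S" by (rule res[OF e])
    have "x = (\<Sum>k<K. sqrt (r (fst (?g k)) * p (snd (?g k)) * t k))\<^sup>2" by (simp add: x v)
    also have "\<dots> \<le> sum p {..<S} * score r t K ?g"
      by (rule weighted_sum_le_score[OF _ injectionsD(3)[OF g]]) (use p in \<open>auto simp: prob_dists_def\<close>)
    also have "\<dots> \<le> C" using p le[OF g] by (simp add: prob_dists_def)
    finally show ?thesis .
  qed
  obtain g where g: "g \<in> injections K n S" "score r t K g = C" using ex by blast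
  note gN = injectionsD(3)[OF g(1)] and gn = injectionsD(4)[OF g(1)]
  define w where "w s = (\<Sum>k | k < K \<and> snd (g k) = s. sqrt (r (fst (g k)) * t k))" for s
  have wC: "(\<Sum>s<S. (w s)\<^sup>2) = C"
    using score_eq[OF _ gN, of r t] g(2) by (simp add: w_def)
  have w0: "0 \<le> w s" for s
    unfolding w_def using gn t(2) r assms(5) by (intro sum_nonneg) (auto intro!: mult_nonneg_nonneg)
  have C0: "0 \<le> C" using g(2) score_nonneg by metis
  \<comment> \<open>This is the equality case of Cauchy-Schwarz. If \<open>C = 0\<close> there is
    nothing to normalize, and a point mass at the letter 0 serves instead.\<close>
  define p where "p s = (if C = 0 then if s = 0 then 1 else 0 else (w s)\<^sup>2 / C)" for s
  have "sum p {..<S} = 1"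
    by (cases "C = 0") (use wC assms(7) in \<open>simp_all add: p_def flip: sum_divide_distrib\<close>)
  then have p: "p \<in> prob_dists {..<S}"
    using C0 by (simp add: prob_dists_def p_def)
  obtain e where e: "decreasing_enumeration ?J (\<lambda>(i, s). r i * p s) e"
    and v: "val p = (\<Sum>k<K. sqrt (r (fst (e k)) * p (snd (e k)) * t k))\<^sup>2"
    using attained[of p] by blast
  have mem: "val p \<in> classical_fidelities {..<S} n r m t"
    unfolding cf using p by blast
  have "C \<le> val p"
  proof (cases "C = 0")
    case False
    have "sqrt C = (\<Sum>s<S. sqrt (p s) * w s)"
    proof -
      have "(\<Sum>s<S. sqrt (p s) * w s) = (\<Sum>s<S. (w s)\<^sup>2 / sqrt C)"
        using False w0 by (intro sum.cong refl) (simp add: p_def real_sqrt_divide power2_eq_square)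
      then show ?thesis using wC C0 by (simp add: real_div_sqrt flip: sum_divide_distrib)
    qed
    also have "\<dots> = (\<Sum>k<K. sqrt (r (fst (g k)) * p (snd (g k)) * t k))"
      unfolding w_def by (rule weighted_sum_eq[OF _ gN, symmetric]) simp
    also have "\<dots> = (\<Sum>k<K. sqrt ((\<lambda>(i, s). r i * p s) (g k)) * sqrt (t k))"
      by (simp add: case_prod_beta real_sqrt_mult)
    \<comment> \<open>Rearrangement: the sorted pairing \<open>e\<close> does at least as well
      against the decreasing \<open>t\<close> as \<open>g\<close>.\<close>
    also have "\<dots> \<le> (\<Sum>k<K. sqrt ((\<lambda>(i, s). r i * p s) (e k)) * sqrt (t k))"
    proof (rule injection_sum_le[where S = ?J])
      show "decreasing_enumeration ?J (\<lambda>x. sqrt ((\<lambda>(i, s). r i * p s) x)) e"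
        using e unfolding decreasing_enumeration_def by simp
      show "0 \<le> sqrt ((\<lambda>(i, s). r i * p s) x)" if "x \<in> ?J" for x
        using that p r by (auto simp: prob_dists_def)
      show "inj_on g {..<K}" "g ` {..<K} \<subseteq> ?J" using injectionsD[OF g(1)] by blast+
    qed (use J assms(5) t in auto)
    also have "\<dots> = (\<Sum>k<K. sqrt (r (fst (e k)) * p (snd (e k)) * t k))"
      by (simp add: case_prod_beta real_sqrt_mult)
    finally have "(sqrt C)\<^sup>2 \<le> val p"
      unfolding v using C0 by (intro power_mono) auto
    then show ?thesis using C0 by simp
  qed (simp add: val_def diag_fidelity_def)
  moreover have "val p \<le> C" by (rule upper[OF mem])
  ultimately show "C \<in> classical_fidelities {..<S} n r m t" using mem by simp
qed


section \<open>Optimality and achievability\<close>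

lemma Bessel:
  assumes "finite I" and e: "\<And>i j. i \<in> I \<Longrightarrow> j \<in> I \<Longrightarrow> cinner (e i) (e j) = (if i = j then 1 else 0)"
  shows "(\<Sum>i\<in>I. (cmod (cinner (e i) z))\<^sup>2) \<le> (norm z)\<^sup>2"
proof -
  define w where "w = z - (\<Sum>i\<in>I. cinner (e i) z *s e i)"
  have ew: "cinner (e i) w = 0" if "i \<in> I" for i
  proof -
    have "(\<Sum>j\<in>I. cinner (e j) z * cinner (e i) (e j)) = (\<Sum>j\<in>I. if j = i then cinner (e j) z else 0)"
      using e that by (intro sum.cong) auto
    then show ?thesis
      using assms(1) that by (simp add: w_def cinner_diff_right cinner_sum_right cinner_scale_right)
  qed
  have "cinner w w = cinner z w - (\<Sum>i\<in>I. cnj (cinner (e i) z) * cinner (e i) w)"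
    by (subst (1) w_def) (simp add: cinner_diff_left cinner_sum_left cinner_scale_left)
  also have "\<dots> = cinner z w" using ew by simp
  also have "\<dots> = cinner z z - (\<Sum>i\<in>I. cinner (e i) z * cinner z (e i))"
    by (simp add: w_def cinner_diff_right cinner_sum_right cinner_scale_right)
  also have "(\<Sum>i\<in>I. cinner (e i) z * cinner z (e i)) = complex_of_real (\<Sum>i\<in>I. (cmod (cinner (e i) z))\<^sup>2)"
    unfolding of_real_sum
    by (intro sum.cong refl) (simp only: complex_norm_square cnj_cinner)
  finally have "complex_of_real ((norm w)\<^sup>2) = complex_of_real ((norm z)\<^sup>2 - (\<Sum>i\<in>I. (cmod (cinner (e i) z))\<^sup>2))"
    unfolding cinner_self_norm of_real_diff .
  then have "(norm w)\<^sup>2 = (norm z)\<^sup>2 - (\<Sum>i\<in>I. (cmod (cinner (e i) z))\<^sup>2)"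
    by (simp only: of_real_eq_iff)
  then show ?thesis using zero_le_power2[of "norm w"] by linarith
qed

lemma score_cong:
  assumes "\<And>k. k < K \<Longrightarrow> g k = h k" shows "score r t K g = score r t K h"
proof -
  have "g ` {..<K} = h ` {..<K}" using assms by auto
  then show ?thesis
    unfolding score_def
    by (intro sum.cong arg_cong[where f = "\<lambda>x. x\<^sup>2"]) (use assms in auto)
qed

text \<open>\<open>K\<close> indices use at most \<open>K\<close> letters, which can be renamed into
  \<open>{..<K}\<close>. This is where the size of the alphabet comes from.\<close>

lemma relabel_injection:
  fixes g :: "nat \<Rightarrow> nat \<times> nat"
  assumes "inj_on g {..<K}" "\<And>k. k < K \<Longrightarrow> fst (g k) < n"
  shows "\<exists>h\<in>injections K n K. score r t K h = score r t K g"
proof -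
  let ?A = "snd ` g ` {..<K}"
  have "card ?A \<le> card {..<K}" by (metis card_image_le finite_imageI finite_lessThan le_trans)
  then obtain f where f: "f ` ?A \<subseteq> {..<K}" "inj_on f ?A"
    using card_le_inj[of ?A "{..<K}"] by auto
  let ?h = "\<lambda>k. (fst (g k), f (snd (g k)))"
  have "inj_on ?h {..<K}"
  proof (rule inj_onI)
    fix k l assume kl: "k \<in> {..<K}" "l \<in> {..<K}" "?h k = ?h l"
    then have "snd (g k) = snd (g l)" using f(2) by (auto simp: inj_on_def)
    then have "g k = g l" using kl(3) by (simp add: prod_eq_iff)
    then show "k = l" using inj_onD[OF assms(1)] kl by blast
  qed
  moreover have "?h k \<in> {..<n} \<times> {..<K}" if "k < K" for k
    using f(1) assms(2) that by auto
  ultimately have "restrict ?h {..<K} \<in> injections K n K"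
    unfolding injections_def mem_Collect_eq restrict_PiE_iff inj_on_restrict_eq by blast
  moreover have "score r t K (restrict ?h {..<K}) = score r t K g"
    using score_relabel[OF f(2), of r t] score_cong[of K "restrict ?h {..<K}" ?h] by simp
  ultimately show ?thesis by blast
qed

lemma sum_pair_swap: "(\<Sum>j\<in>B. \<Sum>i\<in>A. G (i, j)) = sum G (A \<times> B)"
  by (subst sum.swap) (simp add: sum.cartesian_product)

text \<open>\<open>X\<close> and \<open>Y\<close> stand for the overlaps of the two local isometries
  with product vectors, \<open>s\<close> for singular values. Weighting \<open>s j\<close> by
  \<open>sqrt (p j)\<close> linearizes the sum of squares; AM-GM separates \<open>X\<close> from
  \<open>Y\<close>, rearrangement selects an injection, and Cauchy-Schwarz removes
  \<open>p\<close>.\<close>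

lemma substochastic_value_le_score:
  fixes X Y :: "nat \<Rightarrow> nat \<Rightarrow> nat \<Rightarrow> complex"
  assumes r: "\<And>i. i < n \<Longrightarrow> 0 \<le> r i" and "0 < n"
    and t: "\<And>i j. i \<le> j \<Longrightarrow> j < K \<Longrightarrow> t j \<le> t i" "\<And>k. k < K \<Longrightarrow> 0 \<le> t k"
    and X: "\<And>k. k < K \<Longrightarrow> (\<Sum>(i, j)\<in>{..<n} \<times> {..<q}. (cmod (X i j k))\<^sup>2) \<le> 1"
      "\<And>i j. i < n \<Longrightarrow> j < q \<Longrightarrow> (\<Sum>k<K. (cmod (X i j k))\<^sup>2) \<le> 1"
    and Y: "\<And>k. k < K \<Longrightarrow> (\<Sum>(i, j)\<in>{..<n} \<times> {..<q}. (cmod (Y i j k))\<^sup>2) \<le> 1"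
      "\<And>i j. i < n \<Longrightarrow> j < q \<Longrightarrow> (\<Sum>k<K. (cmod (Y i j k))\<^sup>2) \<le> 1"
    and s: "\<And>j. j < q \<Longrightarrow> 0 \<le> s j"
      "\<And>j. j < q \<Longrightarrow> complex_of_real (s j) =
        (\<Sum>i<n. \<Sum>k<K. complex_of_real (sqrt (r i) * sqrt (t k)) * (X i j k * Y i j k))"
  shows "\<exists>g\<in>injections K n K. (\<Sum>j<q. (s j)\<^sup>2) \<le> score r t K g"
proof -
  define Z where "Z = (\<Sum>j<q. (s j)\<^sup>2)"
  \<comment> \<open>The grid must have room for \<open>K\<close> indices even if
    \<open>q < K\<close>; the added letters get weight 0.\<close>
  define S where "S = max q K"
  \<comment> \<open>Proportional to the squares, so that the \<open>s j\<close> weighted by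
    \<open>sqrt (p j)\<close> add up to \<open>sqrt Z\<close>.\<close>
  define p where "p j = (if j < q then (s j)\<^sup>2 / Z else 0)" for j
  \<comment> \<open>By AM-GM this mean dominates the modulus of the product of \<open>X\<close> and
    \<open>Y\<close>, and it inherits their row and column bounds.\<close>
  define D where "D = (\<lambda>(i, j) k. if j < q then ((cmod (X i j k))\<^sup>2 + (cmod (Y i j k))\<^sup>2) / 2 else 0)"
  define a where "a = (\<lambda>(i, j). sqrt (r i * p j))"
  let ?J = "{..<n} \<times> {..<S}"
  have Z0: "0 \<le> Z" by (simp add: Z_def sum_nonneg)
  have p0: "0 \<le> p j" for j using Z0 by (simp add: p_def)
  have "K \<le> n * S" using \<open>0 < n\<close> by (cases n) (auto simp: S_def)
  then have J: "finite ?J" "K \<le> card ?J" by auto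
  obtain e where e: "decreasing_enumeration ?J a e"
    using decreasing_enumeration_exists[OF J(1)] by blast
  have eb: "inj_on e {..<card ?J}" "e ` {..<card ?J} = ?J"
    using e unfolding decreasing_enumeration_def bij_betw_def by (simp_all only:)
  have sub: "{..<K} \<subseteq> {..<card ?J}" using J(2) by (simp only: lessThan_subset_iff)
  have einj: "inj_on e {..<K}" by (rule inj_on_subset[OF eb(1) sub])
  have "e ` {..<K} \<subseteq> ?J" using image_mono[OF sub, of e] unfolding eb(2) .
  then have "e k \<in> ?J" if "k < K" for k using that by blast
  then have eJ: "fst (e k) < n" "snd (e k) < S" if "k < K" for k
    using that by (force simp: mem_Times_iff)+
  have "Z \<le> score r t K e"
  proof (cases "Z = 0")
    case True
    then show ?thesis using score_nonneg by simp
  next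
    case False
    then have Z: "0 < Z" using Z0 by simp
    have bound: "sqrt (p j) * (sqrt (r i) * sqrt (t k)) * Re (X i j k * Y i j k) \<le>
        a (i, j) * sqrt (t k) * D (i, j) k" if "i < n" "j < q" "k < K" for i j k
    proof -
      have "Re (X i j k * Y i j k) \<le> cmod (X i j k) * cmod (Y i j k)"
        using complex_Re_le_cmod[of "X i j k * Y i j k"] by (simp add: norm_mult)
      also have "\<dots> \<le> D (i, j) k"
        using zero_le_power2[of "cmod (X i j k) - cmod (Y i j k)"] that
        by (simp add: D_def power2_eq_square algebra_simps)
      finally have "sqrt (p j) * sqrt (r i) * sqrt (t k) * Re (X i j k * Y i j k) \<le>
          sqrt (p j) * sqrt (r i) * sqrt (t k) * D (i, j) k"
        using p0 r t(2) that by (intro mult_left_mono mult_nonneg_nonneg) auto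
      then show ?thesis by (simp add: a_def real_sqrt_mult mult_ac)
    qed
    have sj: "s j = (\<Sum>i<n. \<Sum>k<K. sqrt (r i) * sqrt (t k) * Re (X i j k * Y i j k))" if "j < q" for j
    proof -
      have "s j = Re (complex_of_real (s j))" by simp
      also have "\<dots> = (\<Sum>i<n. \<Sum>k<K. sqrt (r i) * sqrt (t k) * Re (X i j k * Y i j k))"
        unfolding s(2)[OF that] Re_sum by (intro sum.cong refl) simp
      finally show ?thesis .
    qed
    have "sqrt Z = (\<Sum>j<q. sqrt (p j) * s j)"
    proof -
      have "(\<Sum>j<q. sqrt (p j) * s j) = (\<Sum>j<q. (s j)\<^sup>2 / sqrt Z)"
        using s(1) by (intro sum.cong refl) (simp add: p_def real_sqrt_divide power2_eq_square)
      also have "\<dots> = Z / sqrt Z" unfolding Z_def by (rule sum_divide_distrib[symmetric])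
      finally show ?thesis using Z0 by (simp add: real_div_sqrt)
    qed
    also have "\<dots> = (\<Sum>j<q. \<Sum>i<n. \<Sum>k<K. sqrt (p j) * (sqrt (r i) * sqrt (t k)) * Re (X i j k * Y i j k))"
      by (intro sum.cong refl) (simp add: sj sum_distrib_left mult.assoc)
    also have "\<dots> \<le> (\<Sum>j<q. \<Sum>i<n. \<Sum>k<K. a (i, j) * sqrt (t k) * D (i, j) k)"
      using bound by (intro sum_mono) simp
    also have "\<dots> = (\<Sum>j<S. \<Sum>i<n. \<Sum>k<K. a (i, j) * sqrt (t k) * D (i, j) k)"
      by (intro sum.mono_neutral_left) (auto simp: S_def D_def)
    also have "\<dots> = (\<Sum>x\<in>?J. \<Sum>k<K. a x * sqrt (t k) * D x k)"
      by (rule sum_pair_swap)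
    also have "\<dots> \<le> (\<Sum>k<K. a (e k) * sqrt (t k))"
    proof (rule substochastic_sum_le[OF J e])
      show "0 \<le> a x" if "x \<in> ?J" for x
        using that r p0 by (auto simp: a_def)
      show "0 \<le> D x k" for x k by (simp add: D_def case_prod_beta)
      fix k assume k: "k < K"
      have "(\<Sum>x\<in>?J. D x k) = (\<Sum>x\<in>{..<n} \<times> {..<q}. D x k)"
        by (intro sum.mono_neutral_right) (auto simp: S_def D_def split: if_splits)
      also have "\<dots> = ((\<Sum>(i, j)\<in>{..<n} \<times> {..<q}. (cmod (X i j k))\<^sup>2) +
          (\<Sum>(i, j)\<in>{..<n} \<times> {..<q}. (cmod (Y i j k))\<^sup>2)) / 2"
        unfolding sum.distrib[symmetric] sum_divide_distrib
        by (intro sum.cong refl) (auto simp: D_def)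
      also have "\<dots> \<le> 1" using X(1)[OF k] Y(1)[OF k] by simp
      finally show "(\<Sum>x\<in>?J. D x k) \<le> 1" .
    next
      fix x assume x: "x \<in> ?J"
      show "(\<Sum>k<K. D x k) \<le> 1"
      proof (cases "snd x < q")
        case True
        have "(\<Sum>k<K. D x k) = ((\<Sum>k<K. (cmod (X (fst x) (snd x) k))\<^sup>2) +
          (\<Sum>k<K. (cmod (Y (fst x) (snd x) k))\<^sup>2)) / 2"
          unfolding sum.distrib[symmetric] sum_divide_distrib
          using True by (intro sum.cong refl) (auto simp: D_def case_prod_beta)
        also have "\<dots> \<le> 1" using X(2)[of "fst x" "snd x"] Y(2)[of "fst x" "snd x"] True x by auto
        finally show ?thesis .
      qed (simp add: D_def case_prod_beta)
    qed (use t in auto)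
    also have "\<dots> = (\<Sum>k<K. sqrt (r (fst (e k)) * p (snd (e k)) * t k))"
      by (simp add: a_def case_prod_beta real_sqrt_mult)
    finally have "(sqrt Z)\<^sup>2 \<le> (\<Sum>k<K. sqrt (r (fst (e k)) * p (snd (e k)) * t k))\<^sup>2"
      using Z0 by (intro power_mono) auto
    also have "\<dots> \<le> sum p {..<S} * score r t K e"
      by (rule weighted_sum_le_score) (use p0 eJ in auto)
    also have "sum p {..<S} = (\<Sum>j<q. (s j)\<^sup>2 / Z)"
      by (intro sum.mono_neutral_cong_right) (auto simp: p_def S_def)
    also have "\<dots> = 1" using False unfolding sum_divide_distrib[symmetric] Z_def[symmetric] by simp
    finally show ?thesis using Z0 by simp
  qed
  then show ?thesis
    using relabel_injection[OF einj eJ(1)] unfolding Z_def by metis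
qed

lemma cinner_schmidt:
  assumes "schmidt_decomposition \<psi> n r u v" "schmidt_decomposition \<phi> m t u' v'"
  shows "cinner \<psi> (tensor_mat A B *v \<phi>) = (\<Sum>i<n. \<Sum>k<m. complex_of_real (sqrt (r i) * sqrt (t k)) *
    (cinner (u i) (A *v u' k) * cinner (v i) (B *v v' k)))"
proof -
  have "\<psi> = (\<Sum>i<n. complex_of_real (sqrt (r i)) *s tensor_vec (u i) (v i))"
    and "\<phi> = (\<Sum>k<m. complex_of_real (sqrt (t k)) *s tensor_vec (u' k) (v' k))"
    using assms by (simp_all only: schmidt_decomposition_def)
  then show ?thesis
    by (simp add: mult_vec_sum vector_scalar_commute tensor_mat_mult_vec cinner_sum_left
        cinner_sum_right cinner_scale_left cinner_scale_right cinner_tensor_vec sum_distrib_left mult_ac)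
      (rule sum.swap)
qed

text \<open>The Stinespring isometry \<open>x \<mapsto> \<Sum>\<^sub>c |c> \<otimes> K\<^sub>c x\<close>.\<close>

definition kraus_stack :: "('k \<Rightarrow> complex ^ 'n ^ 'n) \<Rightarrow> complex ^ 'n::finite \<Rightarrow> complex ^ ('k::finite \<times> 'n)" where
  "kraus_stack K x = (\<chi> p. (K (fst p) *v x) $ snd p)"

lemma cinner_tensor_kraus_stack:
  "cinner (tensor_vec x u) (kraus_stack K w) = (\<Sum>c\<in>UNIV. cnj (x $ c) * cinner u (K c *v w))"
  by (simp add: cinner_def tensor_vec_def kraus_stack_def sum_UNIV_prod sum_distrib_left mult_ac)

lemma cinner_kraus_stack:
  assumes "(\<Sum>c\<in>UNIV. cadjoint (K c) ** K c) = mat 1"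
  shows "cinner (kraus_stack K x) (kraus_stack K y) = cinner x y"
proof -
  have "cinner (kraus_stack K x) (kraus_stack K y) = (\<Sum>c\<in>UNIV. cinner (K c *v x) (K c *v y))"
    by (simp add: cinner_def kraus_stack_def sum_UNIV_prod)
  also have "\<dots> = cinner x ((\<Sum>c\<in>UNIV. cadjoint (K c) ** K c) *v y)"
    by (simp add: sum_mult_vec cinner_sum_right cinner_mult_left flip: matrix_vector_mul_assoc)
  finally show ?thesis by (simp add: assms)
qed

text \<open>\<open>kraus_stack K\<close> is an isometry, so the images of the \<open>w k\<close> are
  orthonormal, as are the product vectors. Bessel's inequality for either family makes the squared
  overlaps doubly substochastic.\<close>

lemma kraus_stack_Bessel:
  assumes K: "(\<Sum>c\<in>UNIV. cadjoint (K c) ** K c) = mat 1"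
    and w: "orthonormal m w" and x: "orthonormal q x" and u: "orthonormal n u"
  shows "k < m \<Longrightarrow> (\<Sum>(i, j)\<in>{..<n} \<times> {..<q}. (cmod (cinner (tensor_vec (x j) (u i)) (kraus_stack K (w k))))\<^sup>2) \<le> 1"
    and "i < n \<Longrightarrow> j < q \<Longrightarrow> k \<le> m \<Longrightarrow>
      (\<Sum>l<k. (cmod (cinner (tensor_vec (x j) (u i)) (kraus_stack K (w l))))\<^sup>2) \<le> 1"
proof -
  have unit: "(norm z)\<^sup>2 = 1" if "cinner z z = 1" for z :: "complex ^ 'd::finite"
    using that unfolding cinner_self_norm of_real_eq_1_iff .
  note o = w[unfolded orthonormal_def, rule_format] x[unfolded orthonormal_def, rule_format]
    u[unfolded orthonormal_def, rule_format]
  {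
    assume "k < m"
    then have "cinner (kraus_stack K (w k)) (kraus_stack K (w k)) = 1"
      unfolding cinner_kraus_stack[OF K] using o(1) by simp
    then have n: "(norm (kraus_stack K (w k)))\<^sup>2 = 1" by (rule unit)
    have "(\<Sum>p\<in>{..<n} \<times> {..<q}. (cmod (cinner (tensor_vec (x (snd p)) (u (fst p))) (kraus_stack K (w k))))\<^sup>2)
        \<le> (norm (kraus_stack K (w k)))\<^sup>2"
      by (rule Bessel) (auto simp: cinner_tensor_vec o split: if_splits)
    then show "(\<Sum>(i, j)\<in>{..<n} \<times> {..<q}. (cmod (cinner (tensor_vec (x j) (u i)) (kraus_stack K (w k))))\<^sup>2) \<le> 1"
      by (simp add: n case_prod_beta)
  }
  {
    assume ij: "i < n" "j < q" and k: "k \<le> m"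
    have "cinner (tensor_vec (x j) (u i)) (tensor_vec (x j) (u i)) = 1"
      using o ij by (simp add: cinner_tensor_vec)
    then have n: "(norm (tensor_vec (x j) (u i)))\<^sup>2 = 1" by (rule unit)
    have "(\<Sum>l<k. (cmod (cinner (kraus_stack K (w l)) (tensor_vec (x j) (u i))))\<^sup>2)
        \<le> (norm (tensor_vec (x j) (u i)))\<^sup>2"
      by (rule Bessel) (use k in \<open>auto simp: cinner_kraus_stack[OF K] o\<close>)
    then show "(\<Sum>l<k. (cmod (cinner (tensor_vec (x j) (u i)) (kraus_stack K (w l))))\<^sup>2) \<le> 1"
      by (simp add: n cmod_cinner_commute)
  }
qed

text \<open>The fidelity is the squared Frobenius norm of the amplitude matrix \<open>N\<close>,
  hence the sum of its squared singular values. Singular bases merge the two Kraus indices into the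
  single letter \<open>j\<close>, and each \<open>s j\<close> becomes a sum of products as in
  \<open>substochastic_value_le_score\<close>.\<close>

lemma fidelity_le_score:
  fixes \<psi> \<phi> :: "complex ^ ('a::finite \<times> 'b::finite)"
  assumes \<psi>: "schmidt_decomposition \<psi> n r u v" and \<phi>: "schmidt_decomposition \<phi> m t u' v'"
    and "0 < n" "K \<le> m" and t0: "\<And>k. K \<le> k \<Longrightarrow> k < m \<Longrightarrow> t k = 0"
    and "channel E" "channel F"
  shows "\<exists>g\<in>injections K n K. fidelity (proj \<psi>) (tensor_map E F (proj \<phi>)) \<le> score r t K g"
proof -
  note \<psi>' = \<psi>[unfolded schmidt_decomposition_def] and \<phi>' = \<phi>[unfolded schmidt_decomposition_def]
  obtain A :: "'a \<times> 'a \<Rightarrow> complex ^ 'a ^ 'a" where A: "E = kraus_map UNIV A" "(\<Sum>c\<in>UNIV. cadjoint (A c) ** A c) = mat 1"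
    using channel_kraus[OF assms(6)] by blast
  obtain B :: "'b \<times> 'b \<Rightarrow> complex ^ 'b ^ 'b" where B: "F = kraus_map UNIV B" "(\<Sum>d\<in>UNIV. cadjoint (B d) ** B d) = mat 1"
    using channel_kraus[OF assms(7)] by blast
  define N :: "complex ^ ('b \<times> 'b) ^ ('a \<times> 'a)" where "N = (\<chi> c d. cinner \<psi> (tensor_mat (A c) (B d) *v \<phi>))"
  obtain q s and x :: "nat \<Rightarrow> complex ^ ('a \<times> 'a)" and y :: "nat \<Rightarrow> complex ^ ('b \<times> 'b)" where x: "orthonormal q x" and y: "orthonormal q y" and s: "\<And>i. 0 < s i"
    and Ny: "\<And>i. i < q \<Longrightarrow> N *v y i = complex_of_real (s i) *s x i"
    and sq: "(\<Sum>a\<in>UNIV. \<Sum>b\<in>UNIV. (cmod (N $ a $ b))\<^sup>2) = (\<Sum>i<q. (s i)\<^sup>2)"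
    using singular_value_decomposition[of N] by blast
  \<comment> \<open>\<open>s j = \<Sum>\<^sub>c\<^sub>d cnj (x j $ c) * N\<^sub>c\<^sub>d * y j $ d\<close>, so Bob's vector enters conjugated.\<close>
  define y' where "y' j = (\<chi> d. cnj (y j $ d))" for j
  have y': "orthonormal q y'"
  proof -
    have "cinner (y' i) (y' j) = cnj (cinner (y i) (y j))" for i j
      by (simp add: cinner_def y'_def)
    then show ?thesis using y by (simp add: orthonormal_def)
  qed
  define X where "X i j k = cinner (tensor_vec (x j) (u i)) (kraus_stack A (u' k))" for i j k
  define Y where "Y i j k = cinner (tensor_vec (y' j) (v i)) (kraus_stack B (v' k))" for i j k
  have "\<exists>g\<in>injections K n K. (\<Sum>j<q. (s j)\<^sup>2) \<le> score r t K g"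
  proof (rule substochastic_value_le_score[where X = X and Y = Y])
    fix j assume j: "j < q"
    have Nyj: "(N *v y j) $ c = (\<Sum>d\<in>UNIV. cinner \<psi> (tensor_mat (A c) (B d) *v \<phi>) * y j $ d)" for c
      unfolding matrix_vector_mult_def[of N] by (simp add: N_def)
    have "complex_of_real (s j) = cinner (x j) (N *v y j)"
      using x j by (simp add: Ny cinner_scale_right orthonormal_def)
    also have "\<dots> = (\<Sum>c\<in>UNIV. \<Sum>d\<in>UNIV. \<Sum>i<n. \<Sum>k<m. complex_of_real (sqrt (r i) * sqrt (t k)) *
        (cnj (x j $ c) * cinner (u i) (A c *v u' k) * (y j $ d * cinner (v i) (B d *v v' k))))"
      by (simp add: cinner_def[of "x j"] Nyj cinner_schmidt[OF \<psi> \<phi>]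
          sum_distrib_left sum_distrib_right mult_ac)
    also have "\<dots> = (\<Sum>i<n. \<Sum>k<m. \<Sum>c\<in>UNIV. \<Sum>d\<in>UNIV. complex_of_real (sqrt (r i) * sqrt (t k)) *
        (cnj (x j $ c) * cinner (u i) (A c *v u' k) * (y j $ d * cinner (v i) (B d *v v' k))))"
      by (simp only: sum.swap[where B = "{..<n}" and A = UNIV] sum.swap[where B = "{..<m}" and A = UNIV])
    also have "\<dots> = (\<Sum>i<n. \<Sum>k<m. complex_of_real (sqrt (r i) * sqrt (t k)) * (X i j k * Y i j k))"
      unfolding X_def Y_def cinner_tensor_kraus_stack sum_product
      by (simp add: y'_def sum_distrib_left)
    also have "\<dots> = (\<Sum>i<n. \<Sum>k<K. complex_of_real (sqrt (r i) * sqrt (t k)) * (X i j k * Y i j k))"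
      using assms(4) t0 by (intro sum.cong refl sum.mono_neutral_right) auto
    finally show "complex_of_real (s j) = \<dots>" .
  next
    fix k assume "k < K"
    then show "(\<Sum>(i, j)\<in>{..<n} \<times> {..<q}. (cmod (X i j k))\<^sup>2) \<le> 1"
      "(\<Sum>(i, j)\<in>{..<n} \<times> {..<q}. (cmod (Y i j k))\<^sup>2) \<le> 1"
      unfolding X_def Y_def using assms(4) \<psi>' \<phi>'
      by (auto intro!: kraus_stack_Bessel(1)[OF A(2) _ x] kraus_stack_Bessel(1)[OF B(2) _ y'])
  next
    fix i j assume "i < n" "j < q"
    then show "(\<Sum>k<K. (cmod (X i j k))\<^sup>2) \<le> 1" "(\<Sum>k<K. (cmod (Y i j k))\<^sup>2) \<le> 1"
      unfolding X_def Y_def using assms(4) \<psi>' \<phi>'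
      by (auto intro!: kraus_stack_Bessel(2)[OF A(2) _ x] kraus_stack_Bessel(2)[OF B(2) _ y'])
  qed (use \<psi>' \<phi>' assms(3,4) s in \<open>auto intro: less_imp_le\<close>)
  moreover have "fidelity (proj \<psi>) (tensor_map E F (proj \<phi>)) = (\<Sum>j<q. (s j)\<^sup>2)"
    unfolding A(1) B(1) fidelity_kraus_map sq[symmetric] by (simp add: N_def)
  ultimately show ?thesis by simp
qed

section \<open>Channels attaining a given score\<close>

text \<open>
  The last operator, with index \<open>S\<close>, projects onto the orthogonal complement of the \<open>w k\<close> and only
  serves to make the channel trace preserving.
\<close>

definition transfer_kraus ::
    "(nat \<Rightarrow> complex ^ 'n::finite) \<Rightarrow> (nat \<Rightarrow> complex ^ 'n) \<Rightarrow> nat \<Rightarrow> (nat \<Rightarrow> nat \<times> nat) \<Rightarrow> nat \<Rightarrow> nat \<Rightarrow>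
      complex ^ 'n ^ 'n" where
  "transfer_kraus u w K g S c =
     (if c < S then \<Sum>k | k < K \<and> snd (g k) = c. outer (u (fst (g k))) (w k)
      else mat 1 - (\<Sum>k<K. proj (w k)))"

text \<open>For each letter the operator is a partial isometry, since the vectors
  \<open>u (fst (g k))\<close> within one letter are orthonormal. The initial projections of the
  letters add up to the projection onto the span of the \<open>w k\<close>, and index
  \<open>S\<close> supplies the complement.\<close>

lemma transfer_kraus_complete:
  assumes g: "g \<in> injections K n S" and u: "orthonormal n u" and w: "orthonormal K w"
  shows "(\<Sum>c\<le>S. cadjoint (transfer_kraus u w K g S c) ** transfer_kraus u w K g S c) = mat 1"
proof (rule matrix_cinner_ext)
  fix x y
  let ?T = "transfer_kraus u w K g S"
  note uu = u[unfolded orthonormal_def, rule_format] and ww = w[unfolded orthonormal_def, rule_format]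
  have block: "cinner (?T s *v x) (?T s *v y) = (\<Sum>k | k \<in> {..<K} \<and> snd (g k) = s. cinner x (w k) * cinner (w k) y)"
    if "s < S" for s
  proof -
    let ?I = "{k. k < K \<and> snd (g k) = s}"
    have Tz: "?T s *v z = (\<Sum>k\<in>?I. cinner (w k) z *s u (fst (g k)))" for z
      using that by (simp add: transfer_kraus_def sum_mult_vec outer_mult_vec)
    have "cinner (?T s *v x) (?T s *v y) =
        (\<Sum>l\<in>?I. \<Sum>k\<in>?I. cinner x (w k) * cinner (w l) y * cinner (u (fst (g k))) (u (fst (g l))))"
      unfolding Tz by (simp add: cinner_sum_left cinner_sum_right cinner_scale_left cinner_scale_right
          cnj_cinner mult_ac sum_distrib_left)
    also have "\<dots> = (\<Sum>l\<in>?I. \<Sum>k\<in>?I. if k = l then cinner x (w k) * cinner (w l) y else 0)"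
    proof (intro sum.cong refl)
      fix k l assume kl: "l \<in> ?I" "k \<in> ?I"
      \<comment> \<open>Both pairs carry the letter \<open>s\<close>, so equal first components make
        the pairs equal, and \<open>g\<close> is injective.\<close>
      have "fst (g k) = fst (g l) \<longleftrightarrow> k = l"
        using kl inj_onD[OF injectionsD(1)[OF g], of k l] by (auto simp: prod_eq_iff)
      then show "cinner x (w k) * cinner (w l) y * cinner (u (fst (g k))) (u (fst (g l))) =
          (if k = l then cinner x (w k) * cinner (w l) y else 0)"
        using kl uu injectionsD(4)[OF g] by simp
    qed
    finally show ?thesis by simp
  qed
  define P where "P z = z - (\<Sum>k<K. cinner (w k) z *s w k)" for z
  have last: "?T S *v z = P z" for z
    by (simp add: transfer_kraus_def P_def matrix_vector_mult_diff_rdistrib sum_mult_vec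
        proj_eq_outer outer_mult_vec)
  have wP: "cinner (w k) (P z) = 0" if "k < K" for k z
    using cinner_orthonormal_sum[OF w that, of "\<lambda>k. cinner (w k) z"] by (simp add: P_def cinner_diff_right)
  have "cinner (P x) (P y) = cinner x (P y) - (\<Sum>k<K. cnj (cinner (w k) x) * cinner (w k) (P y))"
    by (subst (1) P_def) (simp add: cinner_diff_left cinner_sum_left cinner_scale_left)
  also have "\<dots> = cinner x (P y)" using wP by simp
  also have "\<dots> = cinner x y - (\<Sum>k<K. cinner x (w k) * cinner (w k) y)"
    by (simp add: P_def cinner_diff_right cinner_sum_right cinner_scale_right mult.commute)
  finally have PP: "cinner (P x) (P y) = cinner x y - (\<Sum>k<K. cinner x (w k) * cinner (w k) y)" .
  have "cinner x ((\<Sum>c\<le>S. cadjoint (?T c) ** ?T c) *v y) = (\<Sum>c\<le>S. cinner (?T c *v x) (?T c *v y))"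
    by (simp add: sum_mult_vec cinner_sum_right cinner_mult_left flip: matrix_vector_mul_assoc)
  also have "\<dots> = (\<Sum>s<S. \<Sum>k | k \<in> {..<K} \<and> snd (g k) = s. cinner x (w k) * cinner (w k) y) + cinner (P x) (P y)"
    by (simp add: lessThan_Suc_atMost[symmetric] block last)
  also have "(\<Sum>s<S. \<Sum>k | k \<in> {..<K} \<and> snd (g k) = s. cinner x (w k) * cinner (w k) y) =
      (\<Sum>k<K. cinner x (w k) * cinner (w k) y)"
    by (rule sum.group) (use injectionsD(5)[OF g] in auto)
  finally show "cinner x ((\<Sum>c\<le>S. cadjoint (?T c) ** ?T c) *v y) = cinner x (mat 1 *v y)"
    by (simp add: PP)
qed

lemma transfer_kraus_mult_vec:
  assumes "orthonormal m w" "K \<le> m" "s < S" "l < m"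
  shows "transfer_kraus u w K g S s *v w l = (if l < K \<and> snd (g l) = s then u (fst (g l)) else 0)"
proof -
  have "transfer_kraus u w K g S s *v w l =
      (\<Sum>k | k < K \<and> snd (g k) = s. cinner (w k) (w l) *s u (fst (g k)))"
    using assms(3) by (simp add: transfer_kraus_def sum_mult_vec outer_mult_vec)
  also have "\<dots> = (\<Sum>k | k < K \<and> snd (g k) = s. if k = l then u (fst (g k)) else 0)"
    using assms by (intro sum.cong refl) (auto simp: orthonormal_def)
  finally show ?thesis by simp
qed

lemma psd_tensor_map: "channel E \<Longrightarrow> channel F \<Longrightarrow> psd (tensor_map E F (proj \<phi>))"
  by (metis channel_kraus psd_tensor_map_kraus_map)

text \<open>When both parties use the same injection, the amplitude for equal outcomes
  \<open>s < S\<close> is exactly the inner sum of the score. All other outcomes, including index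
  \<open>S\<close>, contribute nonnegative terms.\<close>

lemma score_le_fidelity:
  assumes \<psi>: "schmidt_decomposition \<psi> n r u v" and \<phi>: "schmidt_decomposition \<phi> m t u' v'"
    and "K \<le> m" and g: "g \<in> injections K n S"
  shows "\<exists>E F. channel E \<and> channel F \<and>
    score r t K g \<le> fidelity (proj \<psi>) (tensor_map E F (proj \<phi>))"
proof (intro exI conjI)
  note \<psi>' = \<psi>[unfolded schmidt_decomposition_def] and \<phi>' = \<phi>[unfolded schmidt_decomposition_def]
  let ?A = "transfer_kraus u u' K g S" and ?B = "transfer_kraus v v' K g S"
  have on: "orthonormal n u" "orthonormal n v" "orthonormal m u'" "orthonormal m v'"
    "orthonormal K u'" "orthonormal K v'"
    using \<psi>' \<phi>' \<open>K \<le> m\<close> by (auto simp: orthonormal_def)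
  show "channel (kraus_map {..S} ?A)" "channel (kraus_map {..S} ?B)"
    using on by (auto intro!: channel_kraus_map transfer_kraus_complete[OF g])
  let ?N = "\<lambda>c d. cinner \<psi> (tensor_mat (?A c) (?B d) *v \<phi>)"
  have diagonal: "?N s s = complex_of_real (\<Sum>k | k < K \<and> snd (g k) = s. sqrt (r (fst (g k)) * t k))"
    if "s < S" for s
  proof -
    let ?I = "{k. k < K \<and> snd (g k) = s}"
    have "?N s s = (\<Sum>k<m. \<Sum>i<n. complex_of_real (sqrt (r i) * sqrt (t k)) *
        (cinner (u i) (?A s *v u' k) * cinner (v i) (?B s *v v' k)))"
      unfolding cinner_schmidt[OF \<psi> \<phi>] by (rule sum.swap)
    \<comment> \<open>Only \<open>i = fst (g k)\<close> survives on both sides, and only for those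
      \<open>k\<close> whose letter is \<open>s\<close>.\<close>
    also have "\<dots> = (\<Sum>k<m. \<Sum>i<n. if i = fst (g k) then
        if k \<in> ?I then complex_of_real (sqrt (r i * t k)) else 0 else 0)"
    proof (intro sum.cong refl)
      fix k i assume "k \<in> {..<m}" "i \<in> {..<n}"
      then show "complex_of_real (sqrt (r i) * sqrt (t k)) *
          (cinner (u i) (?A s *v u' k) * cinner (v i) (?B s *v v' k)) =
        (if i = fst (g k) then if k \<in> ?I then complex_of_real (sqrt (r i * t k)) else 0 else 0)"
        using on(1,2) injectionsD(4)[OF g, of k]
        by (simp add: transfer_kraus_mult_vec[OF on(3) assms(3) that] transfer_kraus_mult_vec[OF on(4) assms(3) that]
            orthonormal_def real_sqrt_mult)
    qed
    also have "\<dots> = (\<Sum>k<m. if k \<in> ?I then complex_of_real (sqrt (r (fst (g k)) * t k)) else 0)"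
      using injectionsD(4)[OF g] by (intro sum.cong refl) auto
    also have "\<dots> = (\<Sum>k\<in>?I. complex_of_real (sqrt (r (fst (g k)) * t k)))"
      using assms(3) by (intro sum.mono_neutral_cong_right) auto
    finally show ?thesis by simp
  qed
  have "score r t K g = (\<Sum>s<S. (cmod (?N s s))\<^sup>2)"
    unfolding score_eq[OF finite_lessThan injectionsD(3)[OF g]]
    by (intro sum.cong refl) (simp add: diagonal del: of_real_sum)
  also have "\<dots> \<le> (\<Sum>c\<le>S. (cmod (?N c c))\<^sup>2)"
    by (intro sum_mono2) auto
  also have "\<dots> \<le> (\<Sum>c\<le>S. \<Sum>d\<le>S. (cmod (?N c d))\<^sup>2)"
    by (intro sum_mono member_le_sum) auto
  finally show "score r t K g \<le> fidelity (proj \<psi>) (tensor_map (kraus_map {..S} ?A) (kraus_map {..S} ?B) (proj \<phi>))"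
    unfolding fidelity_kraus_map .
qed

section \<open>Maxima and the Schmidt rank\<close>

lemma maximumI:
  assumes "x \<in> S" "\<And>y. y \<in> S \<Longrightarrow> y \<le> x"
  shows "has_maximum S" "maximum S = x"
  using assms by (auto simp: has_maximum_def maximum_def intro: Greatest_equality)

text \<open>The coefficients decrease, so the nonzero ones occupy an initial segment, whose length
  is the rank.\<close>

lemma schmidt_rank_nonzero_iff:
  assumes "schmidt_decomposition \<phi> m t u v"
  shows "schmidt_rank \<phi> \<le> m" and "i < m \<Longrightarrow> t i \<noteq> 0 \<longleftrightarrow> i < schmidt_rank \<phi>"
proof -
  let ?A = "{i. i < m \<and> t i \<noteq> 0}"
  have K: "schmidt_rank \<phi> = card ?A" by (rule schmidt_rank_eq[OF assms])
  have down: "j \<in> ?A" if "i \<in> ?A" "j \<le> i" for i j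
  proof -
    have "0 < t i" "t i \<le> t j"
      using assms that unfolding schmidt_decomposition_def by (force simp: order_less_le)+
    then show ?thesis using that by auto
  qed
  have "card ?A \<le> card {..<m}" by (intro card_mono) auto
  then show "schmidt_rank \<phi> \<le> m" by (simp add: K)
  show "t i \<noteq> 0 \<longleftrightarrow> i < schmidt_rank \<phi>" if "i < m"
  proof
    assume "t i \<noteq> 0"
    then have "{..i} \<subseteq> ?A" using down[of i] that by auto
    then have "card {..i} \<le> card ?A" by (intro card_mono) auto
    then show "i < schmidt_rank \<phi>" by (simp add: K)
  next
    assume i: "i < schmidt_rank \<phi>"
    show "t i \<noteq> 0"
    proof
      assume "t i = 0"
      then have "?A \<subseteq> {..<i}" using down[of _ i] by (auto simp: not_less[symmetric])
      then have "card ?A \<le> card {..<i}" by (intro card_mono) auto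
      then show False using i by (simp add: K)
    qed
  qed
qed

lemma schmidt_rank_pos:
  assumes "\<psi> \<noteq> 0" "schmidt_decomposition \<psi> n r u v"
  shows "0 < schmidt_rank \<psi>"
proof (rule ccontr)
  assume "\<not> 0 < schmidt_rank \<psi>"
  then have "r i = 0" if "i < n" for i
    using schmidt_rank_nonzero_iff(2)[OF assms(2) that] by simp
  then have "\<psi> = 0" using assms(2) by (simp add: schmidt_decomposition_def)
  then show False using assms(1) by simp
qed

text \<open>\<open>maximum\<close> is informative only where a maximum exists, hence the existence
  claims. The lower bound on the joint alphabet ensures that \<open>embed_diag\<close> loses only
  zeros.\<close>

theorem theorem4:
  fixes \<psi> \<phi> :: "complex ^ ('a::finite \<times> 'b::finite)"
    and n m :: nat
    and r t :: "nat \<Rightarrow> real"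
    and u u' :: "nat \<Rightarrow> complex ^ 'a"
    and v v' :: "nat \<Rightarrow> complex ^ 'b"
  assumes "\<psi> \<noteq> 0" and "\<phi> \<noteq> 0"
    and "schmidt_decomposition \<psi> n r u v"
    and "schmidt_decomposition \<phi> m t u' v'"
  shows "\<exists>\<Sigma> :: nat set. finite \<Sigma> \<and> card \<Sigma> \<le> schmidt_rank \<phi> * schmidt_rank \<psi> \<and>
           schmidt_rank \<phi> \<le> card ({..<n} \<times> \<Sigma>) \<and>
           has_maximum (LOSR_fidelities TYPE('l) \<psi> \<phi>) \<and>
           has_maximum (LO_fidelities \<psi> \<phi>) \<and>
           has_maximum (classical_fidelities \<Sigma> n r m t) \<and>
           F_LOSR TYPE('l) \<psi> \<phi> = F_LO \<psi> \<phi> \<and>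
           F_LO \<psi> \<phi> = maximum (classical_fidelities \<Sigma> n r m t)"
proof -
  define K where "K = schmidt_rank \<phi>"
  \<comment> \<open>The common value of all three maxima.\<close>
  define C where "C = Max (score r t K ` injections K n K)"
  note \<psi>' = assms(3)[unfolded schmidt_decomposition_def] and \<phi>' = assms(4)[unfolded schmidt_decomposition_def]
  have pos: "0 < schmidt_rank \<psi>" "0 < K" "0 < n"
    using schmidt_rank_pos[OF assms(1,3)] schmidt_rank_pos[OF assms(2,4)]
      schmidt_rank_nonzero_iff(1)[OF assms(3)] by (auto simp: K_def)
  have "t k = 0" if "K \<le> k" "k < m" for k
    using schmidt_rank_nonzero_iff(2)[OF assms(4) that(2)] that(1) by (simp add: K_def)
  then have K: "K \<le> m" "\<And>k. K \<le> k \<Longrightarrow> k < m \<Longrightarrow> t k = 0" "K \<le> n * K"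
    using schmidt_rank_nonzero_iff(1)[OF assms(4)] pos by (auto simp: K_def)
  have classical: "C \<in> classical_fidelities {..<K} n r m t"
    "\<And>x. x \<in> classical_fidelities {..<K} n r m t \<Longrightarrow> x \<le> C"
    "\<exists>g\<in>injections K n K. score r t K g = C"
    "\<And>g. g \<in> injections K n K \<Longrightarrow> score r t K g \<le> C"
    unfolding C_def
    using classical_fidelities_maximum[of m t K n r K] \<psi>' \<phi>' K pos by auto
  have LO_le: "fidelity (proj \<psi>) (tensor_map E F (proj \<phi>)) \<le> C" if "channel E" "channel F" for E F
    using fidelity_le_score[OF assms(3,4) pos(3) K(1,2) that] classical(4) by (meson order_trans)
  obtain E F where EF: "channel E" "channel F" "C \<le> fidelity (proj \<psi>) (tensor_map E F (proj \<phi>))"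
    using score_le_fidelity[OF assms(3,4) K(1)] classical(3) by metis
  then have C: "fidelity (proj \<psi>) (tensor_map E F (proj \<phi>)) = C" using LO_le by (intro antisym) auto
  have LO_mem: "C \<in> LO_fidelities \<psi> \<phi>" unfolding LO_fidelities_def using EF(1,2) C by blast
  have LO: "has_maximum (LO_fidelities \<psi> \<phi>)" "F_LO \<psi> \<phi> = C"
    unfolding F_LO_def using maximumI[OF LO_mem] LO_le by (auto simp: LO_fidelities_def)
  have LOSR_mem: "C \<in> LOSR_fidelities TYPE('l) \<psi> \<phi>"
  proof -
    \<comment> \<open>A one-point distribution with constant families turns a pair of local channels
      into a case of shared randomness; \<open>undefined\<close> supplies the point.\<close>
    let ?\<mu> = "uniform_count_measure {undefined} :: 'l measure"
    have p: "prob_space ?\<mu>" by (rule prob_space_uniform_count_measure) auto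
    then interpret prob_space ?\<mu> .
    have "(\<integral>l. tensor_map E F (proj \<phi>) \<partial>?\<mu>) = tensor_map E F (proj \<phi>)"
      by (simp add: prob_space)
    then show ?thesis
      unfolding LOSR_fidelities_def mem_Collect_eq using EF(1,2) C p
      by (intro exI[of _ ?\<mu>] exI[of _ "\<lambda>_. E"] exI[of _ "\<lambda>_. F"]) simp
  qed
  have LOSR_le: "x \<le> C" if "x \<in> LOSR_fidelities TYPE('l) \<psi> \<phi>" for x
  proof -
    obtain \<mu> :: "'l measure" and E F where x: "x = fidelity (proj \<psi>) (\<integral>l. tensor_map (E l) (F l) (proj \<phi>) \<partial>\<mu>)"
      and \<mu>: "prob_space \<mu>" "\<And>l. l \<in> space \<mu> \<Longrightarrow> channel (E l)" "\<And>l. l \<in> space \<mu> \<Longrightarrow> channel (F l)"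
        "integrable \<mu> (\<lambda>l. tensor_map (E l) (F l) (proj \<phi>))"
      using \<open>x \<in> LOSR_fidelities TYPE('l) \<psi> \<phi>\<close> unfolding LOSR_fidelities_def by blast
    show ?thesis
      unfolding x using \<mu> LO_le by (intro fidelity_proj_integral_le psd_tensor_map) auto
  qed
  show ?thesis
  \<comment> \<open>One letter per nonzero coefficient of \<phi>; the product bound then follows
    because the rank of \<psi> is positive.\<close>
  proof (intro exI[of _ "{..<K}"] conjI)
    show "card {..<K} \<le> schmidt_rank \<phi> * schmidt_rank \<psi>" using pos(1) by (simp add: K_def)
    show "schmidt_rank \<phi> \<le> card ({..<n} \<times> {..<K})" using K(3) by (simp add: K_def)
  qed (use LO maximumI[OF classical(1,2)] maximumI[OF LOSR_mem LOSR_le] in \<open>auto simp: F_LOSR_def\<close>)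
qed

end
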